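(* Let $\mathbf{k}$ be an algebraically closed field and $\mathbb{A}^2=\mathbb{A}^2_{\mathbf{k}}$. Let $S$ be a subset of $\mathrm{Bir}(\mathbb{A}^2)$ such that $\mathrm{Aut}(\mathbb{A}^2)\cup S$ is a generating set for the monoid $\mathrm{Bir}(\mathbb{A}^2)$. Then $|S|=|\mathbf{k}|$.
   Context: The field $\mathbf{k}$ has arbitrary characteristic. $\mathrm{Bir}(\mathbb{A}^2)$ is the monoid (under composition) of birational morphisms $\mathbb{A}^2\to\mathbb{A}^2$, i.e. morphisms restricting to an isomorphism between nonempty Zariski-open subsets of $\mathbb{A}^2$; its group of invertible elements is $\mathrm{Aut}(\mathbb{A}^2)$. $|\cdot|$ denotes cardinality. *)

theory Defs
  imports
    "HOL-Computational_Algebra.Polynomial"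
    "HOL-Algebra.Group"
    "HOL-Library.Equipollence"
begin

text \<open>
  The affine plane over an algebraically closed field \<open>'a\<close> is the classical variety \<open>'a \<times> 'a\<close>.
  Since \<open>'a\<close> is then infinite and varieties are reduced, a morphism between open subsets of the
  plane is determined by its values on points, so morphisms are represented by functions.
  A morphism defined on an open set \<open>U\<close> is a function on the whole plane of which only the
  values on \<open>U\<close> matter.
\<close>

type_synonym 'a plane = "'a \<times> 'a"

text \<open>
  Elements of \<open>'a[x,y] = 'a[x][y]\<close> are represented by \<open>'a poly poly\<close>: the outer variable is \<open>y\<close>,
  the inner one is \<open>x\<close>.
\<close>

definition eval2 :: "'a::comm_ring_1 poly poly \<Rightarrow> 'a plane \<Rightarrow> 'a" where
  "eval2 p P = poly (poly p [:snd P:]) (fst P)"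

definition zariski_closed :: "'a::alg_closed_field plane set \<Rightarrow> bool" where
  "zariski_closed Z \<longleftrightarrow> (\<exists>I. Z = {P. \<forall>p\<in>I. eval2 p P = 0})"

definition zariski_open :: "'a::alg_closed_field plane set \<Rightarrow> bool" where
  "zariski_open U \<longleftrightarrow> zariski_closed (- U)"

definition regular_on :: "'a::alg_closed_field plane set \<Rightarrow> ('a plane \<Rightarrow> 'a) \<Rightarrow> bool" where
  "regular_on U h \<longleftrightarrow>
     (\<forall>P\<in>U. \<exists>W p q. zariski_open W \<and> P \<in> W \<and> W \<subseteq> U \<and>
        (\<forall>Q\<in>W. eval2 q Q \<noteq> 0 \<and> h Q = eval2 p Q / eval2 q Q))"

text \<open>
  The next two notions are meant for Zariski-open sets \<open>U\<close> and \<open>V\<close>. A map into an open subset of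
  the plane is a morphism iff its two coordinates are regular.
\<close>

definition morphism ::
    "'a::alg_closed_field plane set \<Rightarrow> 'a plane set \<Rightarrow> ('a plane \<Rightarrow> 'a plane) \<Rightarrow> bool" where
  "morphism U V f \<longleftrightarrow> f ` U \<subseteq> V \<and> regular_on U (fst \<circ> f) \<and> regular_on U (snd \<circ> f)"

text \<open>
  The inverse has to be a morphism too: in positive characteristic \<open>p\<close>, the map \<open>(x, y) \<mapsto> (x^p, y)\<close>
  is a bijective morphism of the plane, but not birational.
\<close>

definition isomorphism ::
    "'a::alg_closed_field plane set \<Rightarrow> 'a plane set \<Rightarrow> ('a plane \<Rightarrow> 'a plane) \<Rightarrow> bool" where
  "isomorphism U V f \<longleftrightarrow>
     morphism U V f \<and> (\<exists>g. morphism V U g \<and> (\<forall>P\<in>U. g (f P) = P) \<and> (\<forall>Q\<in>V. f (g Q) = Q))"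

definition birational_morphism :: "('a::alg_closed_field plane \<Rightarrow> 'a plane) \<Rightarrow> bool" where
  "birational_morphism f \<longleftrightarrow>
     morphism UNIV UNIV f \<and>
     (\<exists>U V. zariski_open U \<and> U \<noteq> {} \<and> zariski_open V \<and> V \<noteq> {} \<and> isomorphism U V f)"

definition Bir :: "('a::alg_closed_field plane \<Rightarrow> 'a plane) monoid" where
  "Bir = \<lparr>carrier = {f. birational_morphism f}, mult = (\<circ>), one = id\<rparr>"

definition Aut :: "('a::alg_closed_field plane \<Rightarrow> 'a plane) set" where
  "Aut = {f. isomorphism UNIV UNIV f}"

definition generates_monoid :: "('g, 'b) monoid_scheme \<Rightarrow> 'g set \<Rightarrow> bool" where
  "generates_monoid G A \<longleftrightarrow> A \<subseteq> carrier G \<and> (\<forall>H. submonoid H G \<and> A \<subseteq> H \<longrightarrow> H = carrier G)"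

end

theory Submission
  imports Defs "Berlekamp_Zassenhaus.Unique_Factorization_Poly"
begin

text \<open>
  A contracted prime of a polynomial map \<open>\<phi>\<close> is an irreducible polynomial \<open>t\<close> on whose zero curve \<open>\<phi>\<close>
  is constant. If \<open>\<phi>\<close> is birational and not an automorphism, write \<open>x\<close> or \<open>y\<close> as a reduced fraction in
  the coordinates of \<open>\<phi>\<close>; a prime factor of the pull-back of the denominator is contracted.

  The lower bound comes from the maps
  \<open>f\<^sub>l = (e\<^sub>1 e\<^sub>3, e\<^sub>1 e\<^sub>2)\<close> for \<open>l \<noteq> 0, 1\<close>. They are obtained by blowing up the three points \<open>(0,0)\<close>,
  \<open>(1,0)\<close>, \<open>(0,1)\<close> and deleting the strict transforms of the lines \<open>x = 0\<close>, \<open>y = 0\<close> and of the parabola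
  \<open>(x + l y)\<^sup>2 = x + l\<^sup>2 y\<close>, which passes through all three points; \<open>e\<^sub>1, e\<^sub>2, e\<^sub>3\<close> are the equations of the
  exceptional curves, and the equations of the two lines and of the parabola pull back, up to constants, to
  \<open>e\<^sub>1 e\<^sub>3\<close>, \<open>e\<^sub>1 e\<^sub>2\<close> and \<open>e\<^sub>1 e\<^sub>2 e\<^sub>3\<close>.
  Each of these curves contains two or three of the points. Therefore, if \<open>f\<^sub>l = g \<circ> h\<close> and \<open>g\<close> contracts
  some curve, then \<open>e\<^sub>1, e\<^sub>2, e\<^sub>3\<close> are all in the image of the comorphism of \<open>h\<close>; a linear combination of
  \<open>e\<^sub>2\<close> and \<open>e\<^sub>3\<close> is the coordinate \<open>x\<close>, which is not constant on any \<open>e\<^sub>i = 0\<close>, so \<open>h\<close> contracts nothing.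
  Thus \<open>f\<^sub>l\<close> is irreducible, and every generating set \<open>Aut \<union> S\<close> has a member of \<open>S\<close> equivalent to
  \<open>f\<^sub>l\<close>. An equivalence between \<open>f\<^sub>l\<close> and \<open>f\<^sub>m\<close> maps the configurations of points and curves to each other,
  which forces \<open>m = l\<close> or \<open>m l = 1\<close>; hence the classes are parametrized by \<open>l + 1/l\<close>.
\<close>

section \<open>Bivariate polynomials and polynomial maps\<close>

text \<open>As classical rules, these equivalences make proof search loop.\<close>
declare Unique_Factorization.ufd_class.prime_elem_iff_irreducible [iff del]
  Unique_Factorization.factorial_ring_gcd_class.as_ufd.prime_elem_iff_irreducible [iff del]

text \<open>In a finite field the product of all \<open>X - a\<close>, plus one, would be
  nonconstant without roots.\<close>

lemma infinite_alg_closed_field: "infinite (UNIV :: 'a::alg_closed_field set)"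
proof
  assume fin: "finite (UNIV :: 'a set)"
  define p :: "'a poly" where "p = (\<Prod>a\<in>UNIV. [:-a, 1:]) + 1"
  have "degree (\<Prod>a\<in>UNIV. [:-a, 1:] :: 'a poly) = card (UNIV :: 'a set)"
    by (subst degree_prod_eq_sum_degree) auto
  hence "degree p = card (UNIV :: 'a set)"
    unfolding p_def using fin by (subst degree_add_eq_left) (auto simp: card_gt_0_iff)
  hence "degree p > 0" using fin by (simp add: card_gt_0_iff)
  then obtain x where "poly p x = 0" using alg_closed_imp_poly_has_root by blast
  moreover have "poly p x = 1"
    unfolding p_def using fin by (simp add: poly_prod)
  ultimately show False by simp
qed

section \<open>Evaluation, zeros and units\<close>

definition cst :: "'a::comm_ring_1 \<Rightarrow> 'a poly poly" where "cst a = [:[:a:]:]"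
definition xx :: "'a::comm_ring_1 poly poly" where "xx = [:[:0, 1:]:]"
definition yy :: "'a::comm_ring_1 poly poly" where "yy = [:0, 1:]"

lemma eval2_simps [simp]:
  "eval2 (p + q) P = eval2 p P + eval2 q P"
  "eval2 (p - q) P = eval2 p P - eval2 q P"
  "eval2 (- p) P = - eval2 p P"
  "eval2 (p * q) P = eval2 p P * eval2 q P"
  "eval2 (p ^ n) P = eval2 p P ^ n"
  "eval2 0 P = 0" "eval2 1 P = 1" "eval2 (numeral m) P = numeral m"
  "eval2 (cst a) P = a" "eval2 xx P = fst P" "eval2 yy P = snd P"
  by (simp_all add: eval2_def cst_def xx_def yy_def poly_power)

lemma eval2_pCons [simp]: "eval2 (pCons c p) P = poly c (fst P) + snd P * eval2 p P"
  by (simp add: eval2_def)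

definition eval_x :: "'a::comm_ring_1 \<Rightarrow> 'a poly poly \<Rightarrow> 'a poly" where
  "eval_x x p = map_poly (\<lambda>c. poly c x) p"

lemma coeff_eval_x [simp]: "coeff (eval_x x p) i = poly (coeff p i) x"
  by (simp add: eval_x_def coeff_map_poly)

lemma poly_eval_x [simp]: "poly (eval_x x p) y = eval2 p (x, y)"
  by (induction p) (simp_all add: eval_x_def Polynomial.map_poly_pCons)

text \<open>On each vertical line the polynomial has infinitely many zeros, so each coefficient
  vanishes at every abscissa. By \<open>eval2_eqI\<close>, identities in k[x,y] can then be checked
  point by point.\<close>

lemma eval2_eq_0_iff:
  fixes p :: "'a::alg_closed_field poly poly"
  shows "(\<forall>P. eval2 p P = 0) \<longleftrightarrow> p = 0"
proof
  assume *: "\<forall>P. eval2 p P = 0"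
  have zero: "q = 0" if "\<And>x. poly q x = 0" for q :: "'a poly"
    using poly_roots_finite[of q] that infinite_alg_closed_field by fastforce
  have "eval_x x p = 0" for x by (rule zero) (simp add: *)
  hence "poly (coeff p i) x = 0" for i x by (metis coeff_0 coeff_eval_x)
  thus "p = 0" by - (rule poly_eqI, simp add: zero)
qed simp

lemma eval2_eqI:
  fixes p q :: "'a::alg_closed_field poly poly"
  assumes "\<And>P. eval2 p P = eval2 q P" shows "p = q"
  using eval2_eq_0_iff[of "p - q"] assms by simp

text \<open>A polynomial without zeros is constant on every vertical line, so its coefficients of
  positive degree in y vanish everywhere; what is left is a polynomial in x without roots.\<close>

lemma no_zero_imp_cst:
  fixes p :: "'a::alg_closed_field poly poly"
  assumes "\<And>P. eval2 p P \<noteq> 0" obtains c where "c \<noteq> 0" "p = cst c"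
proof -
  have zero: "q = 0" if "\<And>x. poly q x = 0" for q :: "'a poly"
    using poly_roots_finite[of q] that infinite_alg_closed_field by fastforce
  have nz: "poly (eval_x x p) y \<noteq> 0" for x y using assms by simp
  have "degree (eval_x x p) = 0" for x using nz alg_closed_imp_poly_has_root by blast
  hence "coeff (eval_x x p) i = 0" if "i > 0" for i x
    by (simp add: coeff_eq_0 that del: coeff_eval_x)
  hence "coeff p i = 0" if "i > 0" for i by (intro zero) (use that in simp)
  hence "degree p = 0" by (metis leading_coeff_0_iff gr0I degree_0)
  then obtain q where q: "p = [:q:]" by (metis degree_eq_zeroE)
  have "poly q x \<noteq> 0" for x using assms[of "(x,0)"] q by (simp add: eval2_def)
  hence "degree q = 0" using alg_closed_imp_poly_has_root by blast
  then obtain c where "q = [:c:]" by (metis degree_eq_zeroE)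
  with q assms[of "(0,0)"] that[of c] show ?thesis by (auto simp: cst_def eval2_def)
qed

lemma is_unit_iff_cst:
  fixes p :: "'a::alg_closed_field poly poly"
  shows "is_unit p \<longleftrightarrow> (\<exists>c. c \<noteq> 0 \<and> p = cst c)"
proof
  assume "is_unit p"
  then obtain q where "1 = p * q" by (auto simp: dvd_def)
  hence "eval2 p P * eval2 q P = 1" for P by (metis eval2_simps(4,7))
  hence "eval2 p P \<noteq> 0" for P by (metis mult_zero_left zero_neq_one)
  thus "\<exists>c. c \<noteq> 0 \<and> p = cst c" using no_zero_imp_cst by metis
next
  assume "\<exists>c. c \<noteq> 0 \<and> p = cst c"
  then obtain c where c: "c \<noteq> 0" "p = cst c" by blast
  hence "1 = p * cst (inverse c)" by (intro eval2_eqI) simp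
  thus "is_unit p" unfolding dvd_def by blast
qed

lemma not_unit_has_zero:
  fixes p :: "'a::alg_closed_field poly poly"
  assumes "\<not> is_unit p" obtains P where "eval2 p P = 0"
  using no_zero_imp_cst[of p] assms is_unit_iff_cst by metis

text \<open>The degree of the lexicographically leading monomial. It is additive on products and,
  among nonzero polynomials, is 0 exactly at units: a measure for inductions over
  factorizations.\<close>

definition bidegree :: "'a::alg_closed_field poly poly \<Rightarrow> nat" where
  "bidegree p = degree p + degree (lead_coeff p)"

lemma bidegree_mult:
  assumes "p \<noteq> 0" "q \<noteq> 0" shows "bidegree (p * q) = bidegree p + bidegree q"
  using assms unfolding bidegree_def lead_coeff_mult by (simp add: degree_mult_eq)

lemma bidegree_eq_0_iff: "p \<noteq> 0 \<Longrightarrow> bidegree p = 0 \<longleftrightarrow> is_unit p"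
proof
  assume p: "p \<noteq> 0" "bidegree p = 0"
  hence "degree p = 0" "degree (lead_coeff p) = 0" by (auto simp: bidegree_def)
  then obtain q c where "p = [:q:]" "lead_coeff p = [:c:]" by (metis degree_eq_zeroE)
  hence "p = cst c" by (simp add: cst_def)
  with p show "is_unit p" using is_unit_iff_cst by (metis cst_def pCons_0_0)
next
  assume "is_unit p"
  then obtain c where "c \<noteq> 0" "p = cst c" using is_unit_iff_cst by blast
  thus "bidegree p = 0" by (simp add: bidegree_def cst_def)
qed

text \<open>If q is reducible, one of its factors vanishes at P and has smaller
  \<open>bidegree\<close>; an irreducible q is prime because k[x,y] is factorial.\<close>

lemma prime_factor_at_zero:
  fixes q :: "'a::alg_closed_field poly poly"
  assumes "q \<noteq> 0" "eval2 q P = 0"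
  obtains t where "prime_elem t" "t dvd q" "eval2 t P = 0"
proof -
  have "\<exists>t. prime_elem t \<and> t dvd q \<and> eval2 t P = 0"
    using assms
  proof (induction "bidegree q" arbitrary: q rule: less_induct)
    case less
    show ?case
    proof (cases "irreducible q")
      case True
      thus ?thesis using less.prems by (intro exI[of _ q]) (simp add: Unique_Factorization.ufd_class.prime_elem_iff_irreducible)
    next
      case False
      have "\<not> is_unit q" using less.prems is_unit_iff_cst[of q] by auto
      then obtain a b where ab: "q = a * b" "\<not> is_unit a" "\<not> is_unit b"
        using False less.prems unfolding irreducible_def by blast
      have nz: "a \<noteq> 0" "b \<noteq> 0" using less.prems ab by auto
      have lt: "bidegree a < bidegree q" "bidegree b < bidegree q"
        using ab bidegree_mult[OF nz] bidegree_eq_0_iff[OF nz(1)] bidegree_eq_0_iff[OF nz(2)] by auto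
      have dvd: "a dvd q" "b dvd q" unfolding ab(1) by (rule dvd_triv_left dvd_triv_right)+
      have "eval2 a P * eval2 b P = 0" using less.prems(2) unfolding ab(1) by simp
      then consider "eval2 a P = 0" | "eval2 b P = 0" by auto
      thus ?thesis
      proof cases
        case 1
        from less.hyps[OF lt(1) nz(1) this] obtain t
          where "prime_elem t" "t dvd a" "eval2 t P = 0" by blast
        thus ?thesis using dvd_trans[OF _ dvd(1)] by blast
      next
        case 2
        from less.hyps[OF lt(2) nz(2) this] obtain t
          where "prime_elem t" "t dvd b" "eval2 t P = 0" by blast
        thus ?thesis using dvd_trans[OF _ dvd(2)] by blast
      qed
    qed
  qed
  thus ?thesis using that by blast
qed

lemma prime_factor_exists_poly:
  fixes q :: "'a::alg_closed_field poly poly"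
  assumes "q \<noteq> 0" "\<not> is_unit q"
  obtains t where "prime_elem t" "t dvd q"
  using assms not_unit_has_zero prime_factor_at_zero by metis

text \<open>Common primes are cancelled one at a time and collected in d. Coprimality is stated
  through primes because it is applied to a prime factor of the denominator.\<close>

lemma reduced_fraction:
  fixes p q :: "'a::alg_closed_field poly poly"
  assumes "q \<noteq> 0"
  obtains p' q' d where "p = d * p'" "q = d * q'" "\<And>t. prime_elem t \<Longrightarrow> t dvd q' \<Longrightarrow> \<not> t dvd p'"
proof -
  have "\<exists>p' q' d. p = d * p' \<and> q = d * q' \<and> (\<forall>t. prime_elem t \<longrightarrow> t dvd q' \<longrightarrow> \<not> t dvd p')"
    using assms
  proof (induction "bidegree q" arbitrary: p q rule: less_induct)
    case less
    show ?case
    proof (cases "\<exists>t. prime_elem t \<and> t dvd q \<and> t dvd p")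
      case True
      then obtain t q1 p1 where t: "prime_elem t" "q = t * q1" "p = t * p1" by (auto simp: dvd_def)
      have nz: "q1 \<noteq> 0" "t \<noteq> 0" using less.prems t by auto
      have "bidegree q1 < bidegree q"
        using t nz bidegree_mult[of t q1] bidegree_eq_0_iff[of t] by (auto simp: prime_elem_def)
      from less.hyps[OF this nz(1), of p1] obtain p' q' d where
        "p1 = d * p'" "q1 = d * q'" "\<forall>t. prime_elem t \<longrightarrow> t dvd q' \<longrightarrow> \<not> t dvd p'" by blast
      thus ?thesis using t by (intro exI[of _ p'] exI[of _ q'] exI[of _ "t * d"]) (auto simp: mult_ac)
    next
      case False
      thus ?thesis by (intro exI[of _ p] exI[of _ q] exI[of _ 1]) auto
    qed
  qed
  thus ?thesis using that by blast
qed

section \<open>Polynomial maps and their comorphisms\<close>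

definition pull :: "'a::comm_ring_1 poly poly \<times> 'a poly poly \<Rightarrow> 'a poly poly \<Rightarrow> 'a poly poly" where
  "pull \<phi> p = poly (map_poly (\<lambda>c. poly (map_poly cst c) (fst \<phi>)) p) (snd \<phi>)"

definition pmap :: "'a::comm_ring_1 poly poly \<times> 'a poly poly \<Rightarrow> 'a plane \<Rightarrow> 'a plane" where
  "pmap \<phi> P = (eval2 (fst \<phi>) P, eval2 (snd \<phi>) P)"

lemma fst_pmap [simp]: "fst (pmap \<phi> P) = eval2 (fst \<phi>) P"
  and snd_pmap [simp]: "snd (pmap \<phi> P) = eval2 (snd \<phi>) P"
  by (simp_all add: pmap_def)

lemma eval2_poly_map_cst: "eval2 (poly (map_poly cst c) F) P = poly c (eval2 F P)"
  by (induction c) (simp_all add: Polynomial.map_poly_pCons cst_def)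

lemma pull_pCons: "pull \<phi> (pCons c p) = poly (map_poly cst c) (fst \<phi>) + snd \<phi> * pull \<phi> p"
  by (simp add: pull_def Polynomial.map_poly_pCons cst_def)

lemma eval2_pull [simp]: "eval2 (pull \<phi> p) P = eval2 p (pmap \<phi> P)"
proof (induction p)
  case 0
  show ?case by (simp add: pull_def)
next
  case (pCons c p)
  thus ?case by (simp add: pull_pCons eval2_poly_map_cst)
qed

context
  fixes \<phi> :: "'a::alg_closed_field poly poly \<times> 'a poly poly"
begin

lemma pull_simps [simp]:
  "pull \<phi> (p + q) = pull \<phi> p + pull \<phi> q"
  "pull \<phi> (p - q) = pull \<phi> p - pull \<phi> q"
  "pull \<phi> (- p) = - pull \<phi> p"
  "pull \<phi> (p * q) = pull \<phi> p * pull \<phi> q"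
  "pull \<phi> (p ^ n) = pull \<phi> p ^ n"
  "pull \<phi> 0 = 0" "pull \<phi> 1 = 1" "pull \<phi> (numeral m) = numeral m"
  "pull \<phi> (cst a) = cst a" "pull \<phi> xx = fst \<phi>" "pull \<phi> yy = snd \<phi>"
  by (rule eval2_eqI; simp)+

lemma pull_dvd: "p dvd q \<Longrightarrow> pull \<phi> p dvd pull \<phi> q"
  by (auto simp: dvd_def)

lemma pull_pull: "pull \<phi> (pull \<psi> p) = pull (pull \<phi> (fst \<psi>), pull \<phi> (snd \<psi>)) p"
  by (rule eval2_eqI) (simp add: pmap_def)

lemma pmap_comp: "pmap \<psi> \<circ> pmap \<phi> = pmap (pull \<phi> (fst \<psi>), pull \<phi> (snd \<psi>))"
  by (rule ext) (simp add: pmap_def)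

lemma pmap_inject: "pmap \<phi> = pmap \<psi> \<Longrightarrow> \<phi> = \<psi>"
  by (rule prod_eqI; rule eval2_eqI; metis fst_pmap snd_pmap)

lemma pmap_id: "pmap (xx, yy) = (id :: 'a plane \<Rightarrow> _)"
  by (rule ext) (simp add: pmap_def)

lemma pull_id: "pull (xx, yy) p = (p :: 'a poly poly)"
  by (rule eval2_eqI) (simp add: pmap_def)

end

lemma cong_dvd_mult:
  fixes T :: "'b::comm_ring_1"
  assumes "T dvd a - a'" "T dvd b - b'" shows "T dvd a * b - a' * b'"
proof -
  have "a * b - a' * b' = (a - a') * b + a' * (b - b')" by (simp add: algebra_simps)
  thus ?thesis using assms by (simp add: dvd_add dvd_mult dvd_mult2)
qed

text \<open>Congruence modulo T respects sums and products, hence substitution into q. This replaces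
  computations in the coordinate ring of the curve T = 0.\<close>

lemma pull_cong_dvd:
  fixes T :: "'a::comm_ring_1 poly poly"
  assumes "T dvd fst \<phi> - fst \<psi>" "T dvd snd \<phi> - snd \<psi>"
  shows "T dvd pull \<phi> q - pull \<psi> q"
proof (induction q)
  case 0
  show ?case by (simp add: pull_def)
next
  case (pCons c p)
  have "T dvd poly (map_poly cst c) (fst \<phi>) - poly (map_poly cst c) (fst \<psi>)"
    by (induction c) (use assms(1) in \<open>simp_all add: Polynomial.map_poly_pCons cst_def cong_dvd_mult\<close>)
  moreover have "T dvd snd \<phi> * pull \<phi> p - snd \<psi> * pull \<psi> p"
    by (rule cong_dvd_mult) (use assms pCons in auto)
  ultimately show ?case unfolding pull_pCons by (metis (no_types) add_diff_add dvd_add)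
qed

lemma pull_cong_dvd_cst:
  fixes T :: "'a::alg_closed_field poly poly"
  assumes "T dvd fst \<phi> - cst a" "T dvd snd \<phi> - cst b"
  shows "T dvd pull \<phi> q - cst (eval2 q (a, b))"
proof -
  have "pull (cst a, cst b) q = cst (eval2 q (a, b))"
    by (rule eval2_eqI) (simp add: pmap_def)
  thus ?thesis using pull_cong_dvd[of T \<phi> "(cst a, cst b)" q] assms by simp
qed

section \<open>Birational morphisms of the plane\<close>

lemma zariski_open_basic: "zariski_open {Q. eval2 r Q \<noteq> 0}"
  unfolding zariski_open_def zariski_closed_def by (intro exI[of _ "{r}"]) auto

lemma zariski_openE:
  assumes "zariski_open U" "P \<in> U"
  obtains r where "eval2 r P \<noteq> 0" "\<And>Q. eval2 r Q \<noteq> 0 \<Longrightarrow> Q \<in> U"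
proof -
  obtain I where I: "- U = {P. \<forall>p\<in>I. eval2 p P = 0}"
    using assms(1) unfolding zariski_open_def zariski_closed_def by blast
  with assms(2) obtain r where r: "r \<in> I" "eval2 r P \<noteq> 0" by blast
  have "Q \<in> U" if "eval2 r Q \<noteq> 0" for Q using I r(1) that by blast
  with r(2) show ?thesis using that by blast
qed

text \<open>Density of nonempty principal open sets: p * r vanishes everywhere, and k[x,y] is a
  domain.\<close>

lemma eval2_zero_on_basic_open:
  fixes p r :: "'a::alg_closed_field poly poly"
  assumes "r \<noteq> 0" "\<And>Q. eval2 r Q \<noteq> 0 \<Longrightarrow> eval2 p Q = 0"
  shows "p = 0"
proof -
  have "p * r = 0" using assms(2) by (intro eval2_eqI) auto
  thus ?thesis using assms(1) by simp
qed

lemma eval2_nonzero_imp: "eval2 r P \<noteq> 0 \<Longrightarrow> r \<noteq> 0"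
  by auto

text \<open>All local fractions for h represent one rational function. Its reduced denominator has
  no zero and is therefore constant.\<close>

lemma regular_on_UNIV_imp_polynomial:
  fixes h :: "'a::alg_closed_field plane \<Rightarrow> 'a"
  assumes "regular_on UNIV h"
  obtains p where "h = eval2 p"
proof -
  \<comment> \<open>The fraction is valid near P only, but after clearing the denominator the
    identity holds everywhere, since two local fractions agree on a dense open set.\<close>
  have local: "\<exists>p q. eval2 q P \<noteq> 0 \<and> (\<forall>Q. h Q * eval2 q Q = eval2 p Q)" for P
  proof -
    obtain W p q where W: "zariski_open W" "P \<in> W"
        "\<And>Q. Q \<in> W \<Longrightarrow> eval2 q Q \<noteq> 0 \<and> h Q = eval2 p Q / eval2 q Q"
      using assms unfolding regular_on_def by blast
    obtain r where r: "eval2 r P \<noteq> 0" "\<And>Q. eval2 r Q \<noteq> 0 \<Longrightarrow> Q \<in> W"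
      using zariski_openE[OF W(1,2)] by blast
    have "h Q * eval2 q Q = eval2 p Q" for Q
    proof -
      obtain W' p' q' where W': "zariski_open W'" "Q \<in> W'"
          "\<And>Q. Q \<in> W' \<Longrightarrow> eval2 q' Q \<noteq> 0 \<and> h Q = eval2 p' Q / eval2 q' Q"
        using assms unfolding regular_on_def by blast
      obtain r' where r': "eval2 r' Q \<noteq> 0" "\<And>Q. eval2 r' Q \<noteq> 0 \<Longrightarrow> Q \<in> W'"
        using zariski_openE[OF W'(1,2)] by blast
      have nz: "r * r' \<noteq> 0" using r(1) r'(1) eval2_nonzero_imp by auto
      have "p' * q - p * q' = 0"
      proof (rule eval2_zero_on_basic_open[OF nz])
        fix R assume "eval2 (r * r') R \<noteq> 0"
        hence "R \<in> W" "R \<in> W'" using r(2) r'(2) by auto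
        from W(3)[OF this(1)] W'(3)[OF this(2)]
        show "eval2 (p' * q - p * q') R = 0" by (auto simp: field_simps)
      qed
      hence "eval2 p' Q * eval2 q Q = eval2 p Q * eval2 q' Q"
        by (metis eval2_simps(4) eq_iff_diff_eq_0)
      thus ?thesis using W'(3)[OF W'(2)] by (auto simp: field_simps)
    qed
    thus ?thesis using W(2,3) by blast
  qed
  obtain p0 q0 where pq0: "eval2 q0 (0, 0) \<noteq> 0" "\<And>Q. h Q * eval2 q0 Q = eval2 p0 Q"
    using local by blast
  have "q0 \<noteq> 0" using pq0(1) eval2_nonzero_imp by blast
  then obtain p q d where d: "p0 = d * p" "q0 = d * q" 
      and red: "\<And>t. prime_elem t \<Longrightarrow> t dvd q \<Longrightarrow> \<not> t dvd p"
    using reduced_fraction by blast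
  have nz: "d \<noteq> 0" "q \<noteq> 0" using d \<open>q0 \<noteq> 0\<close> by auto
  have cross: "p * q' = p' * q" if "\<And>Q. h Q * eval2 q' Q = eval2 p' Q" for p' q'
  proof -
    have "d * (p * q') = d * (p' * q)"
    proof (rule eval2_eqI)
      fix Q show "eval2 (d * (p * q')) Q = eval2 (d * (p' * q)) Q"
        using pq0(2)[of Q] that[of Q] unfolding d by (simp add: algebra_simps) (metis mult.assoc mult.commute)
    qed
    thus ?thesis using nz by simp
  qed
  \<comment> \<open>A prime factor t of q through P would divide p * q', where q' is the denominator
    of a fraction valid at P. But t does not divide q', which is nonzero at P, nor p, by
    reducedness.\<close>
  have "eval2 q P \<noteq> 0" for P
  proof
    assume "eval2 q P = 0"
    with nz(2) obtain t where t: "prime_elem t" "t dvd q" "eval2 t P = 0"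
      using prime_factor_at_zero by blast
    obtain p' q' where pq: "eval2 q' P \<noteq> 0" "\<And>Q. h Q * eval2 q' Q = eval2 p' Q"
      using local by blast
    have "t dvd p * q'" using cross[OF pq(2)] t(2) by simp
    hence "t dvd p \<or> t dvd q'" using t(1) by (simp add: prime_elem_dvd_mult_iff)
    moreover have "\<not> t dvd q'" using pq(1) t(3) by (auto simp: dvd_def)
    ultimately show False using red[OF t(1,2)] by blast
  qed
  then obtain c where c: "c \<noteq> 0" "q = cst c" using no_zero_imp_cst by blast
  \<comment> \<open>The fraction found at the origin says nothing at zeros of \<open>q0\<close>, so
    the value at Q is compared through a fraction valid at Q.\<close>
  have "h Q = eval2 (cst (inverse c) * p) Q" for Q
  proof -
    obtain p' q' where pq: "eval2 q' Q \<noteq> 0" "\<And>Q. h Q * eval2 q' Q = eval2 p' Q"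
      using local by blast
    have "eval2 p Q * eval2 q' Q = eval2 p' Q * c"
      using arg_cong[OF cross[OF pq(2)], of "\<lambda>p. eval2 p Q"] c by simp
    thus ?thesis using pq(1) pq(2)[of Q] c by (simp add: field_simps) (metis mult.left_commute mult.commute mult_right_cancel)
  qed
  thus ?thesis using that by blast
qed

lemma regular_on_eval2: "regular_on UNIV (eval2 p)"
  unfolding regular_on_def
proof
  fix P
  show "\<exists>W pa q. zariski_open W \<and> P \<in> W \<and> W \<subseteq> UNIV \<and> (\<forall>Q\<in>W. eval2 q Q \<noteq> 0 \<and> eval2 p Q = eval2 pa Q / eval2 q Q)"
    using zariski_open_basic[of "1 :: 'a poly poly"]
    by (intro exI[of _ UNIV] exI[of _ p] exI[of _ 1]) simp
qed

lemma morphism_UNIV_iff: "morphism UNIV UNIV f \<longleftrightarrow> (\<exists>\<phi>. f = pmap \<phi>)"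
proof
  assume "morphism UNIV UNIV f"
  then obtain F G where "fst \<circ> f = eval2 F" "snd \<circ> f = eval2 G"
    unfolding morphism_def using regular_on_UNIV_imp_polynomial by metis
  hence "f P = pmap (F, G) P" for P by (metis comp_apply fst_pmap snd_pmap fst_conv snd_conv prod_eqI)
  thus "\<exists>\<phi>. f = pmap \<phi>" by blast
next
  assume "\<exists>\<phi>. f = pmap \<phi>"
  then obtain \<phi> where "f = pmap \<phi>" ..
  hence "fst \<circ> f = eval2 (fst \<phi>)" "snd \<circ> f = eval2 (snd \<phi>)" by (auto simp: fun_eq_iff)
  thus "morphism UNIV UNIV f" by (simp add: morphism_def regular_on_eval2)
qed

lemma Aut_iff: "f \<in> Aut \<longleftrightarrow> (\<exists>\<phi> \<psi>. f = pmap \<phi> \<and> pmap \<psi> \<circ> f = id \<and> f \<circ> pmap \<psi> = id)"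
  (is "_ = ?R")
proof
  assume "f \<in> Aut"
  then obtain \<phi> g \<psi> where "f = pmap \<phi>" "g = pmap \<psi>" "\<forall>P. g (f P) = P" "\<forall>Q. f (g Q) = Q"
    unfolding Aut_def isomorphism_def morphism_UNIV_iff by blast
  thus ?R by (intro exI[of _ \<phi>] exI[of _ \<psi>]) (simp add: fun_eq_iff del: split_paired_All)
next
  assume ?R
  thus "f \<in> Aut" unfolding Aut_def isomorphism_def morphism_UNIV_iff mem_Collect_eq
    by (metis comp_apply id_apply)
qed

lemma regular_on_fraction:
  assumes "zariski_open V" "\<And>Q. Q \<in> V \<Longrightarrow> eval2 q Q \<noteq> 0 \<and> h Q = eval2 p Q / eval2 q Q"
  shows "regular_on V h"
  unfolding regular_on_def
proof
  fix P assume "P \<in> V"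
  thus "\<exists>W p q. zariski_open W \<and> P \<in> W \<and> W \<subseteq> V \<and> (\<forall>Q\<in>W. eval2 q Q \<noteq> 0 \<and> h Q = eval2 p Q / eval2 q Q)"
    using assms by (intro exI[of _ V] exI[of _ p] exI[of _ q]) simp
qed

section \<open>Birational morphisms with an explicit rational inverse\<close>

lemma basic_open_nonempty:
  fixes p :: "'a::alg_closed_field poly poly"
  assumes "p \<noteq> 0" shows "{P. eval2 p P \<noteq> 0} \<noteq> {}"
  using assms eval2_eq_0_iff[of p] by auto

text \<open>Birationality with one common denominator d: the open sets of the isomorphism are d
  \<noteq> 0 in the target and its full preimage in the source. This form is convenient for
  composition.\<close>

definition rational_inverse ::
    "'a::alg_closed_field poly poly \<times> 'a poly poly \<Rightarrow> 'a poly poly \<times> 'a poly poly \<Rightarrow> 'a poly poly \<Rightarrow> bool" where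
  "rational_inverse \<phi> n d \<longleftrightarrow> d \<noteq> 0 \<and>
     (\<forall>Q. eval2 d Q \<noteq> 0 \<longrightarrow> pmap \<phi> (eval2 (fst n) Q / eval2 d Q, eval2 (snd n) Q / eval2 d Q) = Q) \<and>
     (\<forall>P Q. Q = pmap \<phi> P \<longrightarrow> eval2 d Q \<noteq> 0 \<longrightarrow> (eval2 (fst n) Q / eval2 d Q, eval2 (snd n) Q / eval2 d Q) = P)"

lemma birational_morphism_if_rational_inverse:
  assumes "rational_inverse \<phi> n d" shows "birational_morphism (pmap \<phi>)"
proof -
  define U where "U = {P. eval2 (pull \<phi> d) P \<noteq> 0}"
  define V where "V = {Q. eval2 d Q \<noteq> 0}"
  define g where "g Q = (eval2 (fst n) Q / eval2 d Q, eval2 (snd n) Q / eval2 d Q)" for Q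
  have op: "zariski_open U" "zariski_open V" unfolding U_def V_def by (rule zariski_open_basic)+
  have g: "pmap \<phi> (g Q) = Q" if "Q \<in> V" for Q
    using assms that unfolding rational_inverse_def V_def g_def by blast
  have g': "g (pmap \<phi> P) = P" if "P \<in> U" for P
    using assms that unfolding rational_inverse_def U_def g_def
    by (simp del: split_paired_All)
  have "V \<noteq> {}" unfolding V_def using assms basic_open_nonempty unfolding rational_inverse_def by blast
  have gU: "g Q \<in> U" if "Q \<in> V" for Q using g[OF that] that by (simp add: U_def V_def)
  have "U \<noteq> {}" using \<open>V \<noteq> {}\<close> gU by blast
  have "regular_on V (fst \<circ> g)" "regular_on V (snd \<circ> g)"
    by (rule regular_on_fraction[OF op(2), of d _ "fst n"], simp add: g_def V_def)
      (rule regular_on_fraction[OF op(2), of d _ "snd n"], simp add: g_def V_def)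
  hence "morphism V U g" using gU unfolding morphism_def by blast
  moreover have "regular_on U (fst \<circ> pmap \<phi>)" "regular_on U (snd \<circ> pmap \<phi>)"
    by (rule regular_on_fraction[OF op(1), of 1 _ "fst \<phi>"], simp)
      (rule regular_on_fraction[OF op(1), of 1 _ "snd \<phi>"], simp)
  hence "morphism U V (pmap \<phi>)" unfolding morphism_def by (auto simp: U_def V_def)
  ultimately have "isomorphism U V (pmap \<phi>)" unfolding isomorphism_def using g g' by blast
  moreover have "morphism UNIV UNIV (pmap \<phi>)" using morphism_UNIV_iff by blast
  ultimately show ?thesis unfolding birational_morphism_def using op \<open>U \<noteq> {}\<close> \<open>V \<noteq> {}\<close> by blast
qed

text \<open>Near one point of V both coordinates of the inverse are fractions. That the inverse
  undoes f is known on U only; density extends it to the whole preimage of d \<noteq> 0.\<close>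

lemma rational_inverse_if_birational_morphism:
  assumes "birational_morphism f"
  obtains \<phi> n d where "f = pmap \<phi>" "rational_inverse \<phi> n d"
proof -
  obtain U V where UV: "zariski_open U" "zariski_open V" "V \<noteq> {}" "isomorphism U V f"
      "morphism UNIV UNIV f"
    using assms unfolding birational_morphism_def by blast
  obtain \<phi> where \<phi>: "f = pmap \<phi>" using UV(5) morphism_UNIV_iff by blast
  obtain g where g: "morphism V U g" "\<And>P. P \<in> U \<Longrightarrow> g (f P) = P" "\<And>Q. Q \<in> V \<Longrightarrow> f (g Q) = Q"
    using UV(4) unfolding isomorphism_def by blast
  obtain Q0 where Q0: "Q0 \<in> V" using UV(3) by blast
  have "\<exists>p q r. eval2 r Q0 \<noteq> 0 \<and> (\<forall>Q. eval2 r Q \<noteq> 0 \<longrightarrow> Q \<in> V \<and> eval2 q Q \<noteq> 0 \<and> h (g Q) = eval2 p Q / eval2 q Q)"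
    if h: "h \<in> {fst, snd}" for h
  proof -
    have "regular_on V (h \<circ> g)" using g(1) h unfolding morphism_def by auto
    then obtain W p q where W: "zariski_open W" "Q0 \<in> W" "W \<subseteq> V"
        "\<And>Q. Q \<in> W \<Longrightarrow> eval2 q Q \<noteq> 0 \<and> h (g Q) = eval2 p Q / eval2 q Q"
      using Q0 unfolding regular_on_def comp_def by blast
    obtain r where "eval2 r Q0 \<noteq> 0" "\<And>Q. eval2 r Q \<noteq> 0 \<Longrightarrow> Q \<in> W" using zariski_openE[OF W(1,2)] by blast
    thus ?thesis using W(3,4) by blast
  qed
  then obtain p1 q1 r1 p2 q2 r2 where
    r: "eval2 r1 Q0 \<noteq> 0" "eval2 r2 Q0 \<noteq> 0" and
    1: "\<And>Q. eval2 r1 Q \<noteq> 0 \<Longrightarrow> Q \<in> V \<and> eval2 q1 Q \<noteq> 0 \<and> fst (g Q) = eval2 p1 Q / eval2 q1 Q" and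
    2: "\<And>Q. eval2 r2 Q \<noteq> 0 \<Longrightarrow> Q \<in> V \<and> eval2 q2 Q \<noteq> 0 \<and> snd (g Q) = eval2 p2 Q / eval2 q2 Q"
    by (metis insertI1 insertI2)
  \<comment> \<open>The factors r1 and r2 make d vanish wherever one of the two local fractions
    might be invalid.\<close>
  define d where "d = q1 * q2 * (r1 * r2)"
  define n where "n = (p1 * q2 * (r1 * r2), p2 * q1 * (r1 * r2))"
  have d0: "eval2 d Q0 \<noteq> 0" using 1[OF r(1)] 2[OF r(2)] r by (simp add: d_def)
  have gn: "(eval2 (fst n) Q / eval2 d Q, eval2 (snd n) Q / eval2 d Q) = g Q" and inV: "Q \<in> V" if "eval2 d Q \<noteq> 0" for Q
  proof -
    have nz: "eval2 r1 Q \<noteq> 0" "eval2 r2 Q \<noteq> 0" using that by (auto simp: d_def)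
    show "Q \<in> V" using 1[OF nz(1)] by blast
    show "(eval2 (fst n) Q / eval2 d Q, eval2 (snd n) Q / eval2 d Q) = g Q"
      using 1[OF nz(1)] 2[OF nz(2)] nz by (intro prod_eqI) (simp_all add: n_def d_def)
  qed
  obtain s where s: "eval2 s (g Q0) \<noteq> 0" "\<And>P. eval2 s P \<noteq> 0 \<Longrightarrow> P \<in> U"
    using zariski_openE[OF UV(1)] g(1) Q0 unfolding morphism_def by blast
  \<comment> \<open>With denominators cleared, the identity is polynomial, so it only has to be
    checked where s and the pullback of d are nonzero.\<close>
  have coord: "x * pull \<phi> d - pull \<phi> m = 0"
    if x: "(x, m) \<in> {(xx, fst n), (yy, snd n)}" for x m
  proof (rule eval2_zero_on_basic_open)
    have "eval2 (s * pull \<phi> d) (g Q0) \<noteq> 0" using s(1) d0 g(3)[OF Q0] by (simp add: \<phi>)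
    thus "s * pull \<phi> d \<noteq> 0" by (rule eval2_nonzero_imp)
    fix P assume "eval2 (s * pull \<phi> d) P \<noteq> 0"
    hence P: "P \<in> U" "eval2 d (f P) \<noteq> 0" using s(2) by (auto simp: \<phi>)
    have "(eval2 (fst n) (f P) / eval2 d (f P), eval2 (snd n) (f P) / eval2 d (f P)) = P"
      using gn[OF P(2)] g(2)[OF P(1)] by simp
    hence "fst P = eval2 (fst n) (f P) / eval2 d (f P)" "snd P = eval2 (snd n) (f P) / eval2 d (f P)"
      by (metis fst_conv, metis snd_conv)
    thus "eval2 (x * pull \<phi> d - pull \<phi> m) P = 0" using x P(2) by (auto simp: \<phi>)
  qed
  have "rational_inverse \<phi> n d"
    unfolding rational_inverse_def
  proof (intro conjI allI impI)
    show "d \<noteq> 0" using d0 by auto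
    show "pmap \<phi> (eval2 (fst n) Q / eval2 d Q, eval2 (snd n) Q / eval2 d Q) = Q" if "eval2 d Q \<noteq> 0" for Q
      unfolding gn[OF that] using g(3)[OF inV[OF that]] \<phi> by simp
    fix P Q assume Q: "Q = pmap \<phi> P" "eval2 d Q \<noteq> 0"
    have "fst P * eval2 d Q - eval2 (fst n) Q = 0" "snd P * eval2 d Q - eval2 (snd n) Q = 0"
      using arg_cong[OF coord[of xx "fst n"], of "\<lambda>q. eval2 q P"]
        arg_cong[OF coord[of yy "snd n"], of "\<lambda>q. eval2 q P"] by (simp_all add: Q(1))
    thus "(eval2 (fst n) Q / eval2 d Q, eval2 (snd n) Q / eval2 d Q) = P"
      using Q(2) by (intro prod_eqI) (simp_all add: field_simps)
  qed
  thus ?thesis using that \<phi> by blast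
qed

text \<open>The functions with a power of d as denominator form a ring that contains the constants
  and both arguments of q.\<close>

lemma eval2_at_fractions:
  fixes d :: "'a::alg_closed_field poly poly"
  obtains M k where "\<And>Q. eval2 d Q \<noteq> 0 \<Longrightarrow>
    eval2 q (eval2 n1 Q / eval2 d Q, eval2 n2 Q / eval2 d Q) = eval2 M Q / eval2 d Q ^ k"
proof -
  define F where "F h \<longleftrightarrow> (\<exists>M k. \<forall>Q. eval2 d Q \<noteq> 0 \<longrightarrow> h Q = eval2 M Q / eval2 d Q ^ k)" for h
  have F_add: "F (\<lambda>Q. g Q + h Q)" if "F g" "F h" for g h
  proof -
    from that obtain M k N m where *: "\<And>Q. eval2 d Q \<noteq> 0 \<Longrightarrow> g Q = eval2 M Q / eval2 d Q ^ k"
      "\<And>Q. eval2 d Q \<noteq> 0 \<Longrightarrow> h Q = eval2 N Q / eval2 d Q ^ m" unfolding F_def by blast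
    have "g Q + h Q = eval2 (M * d ^ m + N * d ^ k) Q / eval2 d Q ^ (k + m)" if "eval2 d Q \<noteq> 0" for Q
      unfolding *[OF that] using that by (simp add: power_add field_simps)
    thus ?thesis unfolding F_def by blast
  qed
  have F_mult: "F (\<lambda>Q. g Q * h Q)" if "F g" "F h" for g h
  proof -
    from that obtain M k N m where "\<And>Q. eval2 d Q \<noteq> 0 \<Longrightarrow> g Q = eval2 M Q / eval2 d Q ^ k"
      "\<And>Q. eval2 d Q \<noteq> 0 \<Longrightarrow> h Q = eval2 N Q / eval2 d Q ^ m" unfolding F_def by blast
    hence "g Q * h Q = eval2 (M * N) Q / eval2 d Q ^ (k + m)" if "eval2 d Q \<noteq> 0" for Q
      using that by (simp add: power_add)
    thus ?thesis unfolding F_def by blast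
  qed
  have F_cst: "F (\<lambda>Q. a)" for a
    unfolding F_def by (intro exI[of _ "cst a"] exI[of _ 0]) simp
  have F_frac: "F (\<lambda>Q. eval2 m Q / eval2 d Q)" for m
    unfolding F_def by (intro exI[of _ m] exI[of _ 1]) simp
  have F_poly: "F (\<lambda>Q. poly c (eval2 n1 Q / eval2 d Q))" for c
  proof (induction c)
    case (pCons a c)
    thus ?case unfolding poly_pCons by (intro F_add F_mult F_cst F_frac)
  qed (simp add: F_cst)
  have "F (\<lambda>Q. eval2 q (eval2 n1 Q / eval2 d Q, eval2 n2 Q / eval2 d Q))"
  proof (induction q)
    case (pCons c q)
    thus ?case unfolding eval2_pCons fst_conv snd_conv by (intro F_add F_mult F_frac F_poly)
  qed (simp add: F_cst)
  thus ?thesis using that unfolding F_def by blast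
qed

lemma birational_morphism_comp:
  assumes "birational_morphism f" "birational_morphism g"
  shows "birational_morphism (f \<circ> g)"
proof -
  obtain \<phi> n d where f: "f = pmap \<phi>" "rational_inverse \<phi> n d"
    using rational_inverse_if_birational_morphism[OF assms(1)] by blast
  obtain \<psi> m e where g: "g = pmap \<psi>" "rational_inverse \<psi> m e"
    using rational_inverse_if_birational_morphism[OF assms(2)] by blast
  define f' where "f' Q = (eval2 (fst n) Q / eval2 d Q, eval2 (snd n) Q / eval2 d Q)" for Q
  define g' where "g' Q = (eval2 (fst m) Q / eval2 e Q, eval2 (snd m) Q / eval2 e Q)" for Q
  have f': "d \<noteq> 0" "\<And>Q. eval2 d Q \<noteq> 0 \<Longrightarrow> f (f' Q) = Q" "\<And>P. eval2 d (f P) \<noteq> 0 \<Longrightarrow> f' (f P) = P"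
    using f unfolding rational_inverse_def f'_def by blast+
  have g': "e \<noteq> 0" "\<And>Q. eval2 e Q \<noteq> 0 \<Longrightarrow> g (g' Q) = Q" "\<And>P. eval2 e (g P) \<noteq> 0 \<Longrightarrow> g' (g P) = P"
    using g unfolding rational_inverse_def g'_def by blast+
  obtain M1 k1 where M1: "\<And>Q. eval2 d Q \<noteq> 0 \<Longrightarrow> eval2 (fst m) (f' Q) = eval2 M1 Q / eval2 d Q ^ k1"
    unfolding f'_def using eval2_at_fractions by blast
  obtain M2 k2 where M2: "\<And>Q. eval2 d Q \<noteq> 0 \<Longrightarrow> eval2 (snd m) (f' Q) = eval2 M2 Q / eval2 d Q ^ k2"
    unfolding f'_def using eval2_at_fractions by blast
  obtain E k3 where E: "\<And>Q. eval2 d Q \<noteq> 0 \<Longrightarrow> eval2 e (f' Q) = eval2 E Q / eval2 d Q ^ k3"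
    unfolding f'_def using eval2_at_fractions by blast
  \<comment> \<open>N / D is the composite of the two inverses. The last factor d makes D vanish
    wherever d does, even if k1 = k2 = 0.\<close>
  define D where "D = E * d ^ k1 * d ^ k2 * d"
  define N where "N = (M1 * d ^ k3 * d ^ k2 * d, M2 * d ^ k3 * d ^ k1 * d)"
  have N: "(eval2 (fst N) Q / eval2 D Q, eval2 (snd N) Q / eval2 D Q) = g' (f' Q)"
    and D: "eval2 d Q \<noteq> 0" "eval2 e (f' Q) \<noteq> 0" if "eval2 D Q \<noteq> 0" for Q
  proof -
    show d: "eval2 d Q \<noteq> 0" using that by (auto simp: D_def)
    have E0: "eval2 E Q \<noteq> 0" using that by (auto simp: D_def)
    show "eval2 e (f' Q) \<noteq> 0" using d E0 E by simp
    show "(eval2 (fst N) Q / eval2 D Q, eval2 (snd N) Q / eval2 D Q) = g' (f' Q)"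
      using d E0 unfolding g'_def by (simp add: M1 M2 E N_def D_def)
  qed
  have comp: "f \<circ> g = pmap (pull \<psi> (fst \<phi>), pull \<psi> (snd \<phi>))" unfolding f(1) g(1) by (rule pmap_comp)
  have "rational_inverse (pull \<psi> (fst \<phi>), pull \<psi> (snd \<phi>)) N D"
    unfolding rational_inverse_def comp[symmetric]
  proof (intro conjI allI impI)
    \<comment> \<open>D is nonzero at f P for a point P outside the zeros of e and of the pullback
      of d. That pullback is not zero because every point with d \<noteq> 0 is a value of f.\<close>
    have "pull \<phi> d \<noteq> 0"
    proof
      assume *: "pull \<phi> d = 0"
      obtain Q where Q: "eval2 d Q \<noteq> 0" using f'(1) eval2_eq_0_iff[of d] by blast
      have "eval2 d Q = eval2 (pull \<phi> d) (f' Q)" using f'(2)[OF Q] by (simp add: f(1))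
      thus False using Q * by simp
    qed
    hence "e * pull \<phi> d \<noteq> 0" using g'(1) by simp
    then obtain P where "eval2 (e * pull \<phi> d) P \<noteq> 0" using eval2_eq_0_iff by blast
    hence P: "eval2 e P \<noteq> 0" "eval2 d (f P) \<noteq> 0" by (auto simp: f(1))
    have "eval2 E (f P) \<noteq> 0" using E[OF P(2)] P f'(3)[OF P(2)] by auto
    hence "eval2 D (f P) \<noteq> 0" using P(2) by (simp add: D_def)
    thus "D \<noteq> 0" by auto
  next
    fix Q assume Q: "eval2 D Q \<noteq> 0"
    show "(f \<circ> g) (eval2 (fst N) Q / eval2 D Q, eval2 (snd N) Q / eval2 D Q) = Q"
      unfolding N[OF Q] using g'(2)[OF D(2)[OF Q]] f'(2)[OF D(1)[OF Q]] by simp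
  next
    fix P Q assume Q: "Q = (f \<circ> g) P" "eval2 D Q \<noteq> 0"
    have "f' Q = g P" using f'(3)[of "g P"] D(1)[OF Q(2)] Q(1) by simp
    thus "(eval2 (fst N) Q / eval2 D Q, eval2 (snd N) Q / eval2 D Q) = P"
      unfolding N[OF Q(2)] using g'(3)[of P] D(2)[OF Q(2)] by simp
  qed
  thus ?thesis unfolding comp by (rule birational_morphism_if_rational_inverse)
qed

text \<open>The second conjunct says that the comorphism is onto on fraction fields.\<close>
definition birational :: "'a::alg_closed_field poly poly \<times> 'a poly poly \<Rightarrow> bool" where
  "birational \<phi> \<longleftrightarrow> (\<forall>q. pull \<phi> q = 0 \<longrightarrow> q = 0) \<and>
     (\<forall>x\<in>{xx, yy}. \<exists>p q. q \<noteq> 0 \<and> x * pull \<phi> q = pull \<phi> p)"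

lemma birational_pull_eq_iff: "birational \<phi> \<Longrightarrow> pull \<phi> p = pull \<phi> q \<longleftrightarrow> p = q"
  unfolding birational_def by (metis pull_simps(2) eq_iff_diff_eq_0)

lemma birational_if_rational_inverse:
  assumes "rational_inverse \<phi> n d" shows "birational \<phi>"
proof -
  have d0: "d \<noteq> 0"
    and right: "\<And>Q. eval2 d Q \<noteq> 0 \<Longrightarrow> pmap \<phi> (eval2 (fst n) Q / eval2 d Q, eval2 (snd n) Q / eval2 d Q) = Q"
    and left: "\<And>P Q. Q = pmap \<phi> P \<Longrightarrow> eval2 d Q \<noteq> 0 \<Longrightarrow>
      (eval2 (fst n) Q / eval2 d Q, eval2 (snd n) Q / eval2 d Q) = P"
    using assms unfolding rational_inverse_def by blast+
  have inj: "q = 0" if "pull \<phi> q = 0" for q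
  proof (rule eval2_zero_on_basic_open[OF d0])
    fix Q assume Q: "eval2 d Q \<noteq> 0"
    have "eval2 q Q = eval2 (pull \<phi> q) (eval2 (fst n) Q / eval2 d Q, eval2 (snd n) Q / eval2 d Q)"
      by (simp only: eval2_pull right[OF Q])
    thus "eval2 q Q = 0" using that by simp
  qed
  have nz: "pull \<phi> d \<noteq> 0" using inj d0 by blast
  have "xx * pull \<phi> d - pull \<phi> (fst n) = 0" "yy * pull \<phi> d - pull \<phi> (snd n) = 0"
  proof -
    have P: "fst P = eval2 (fst n) (pmap \<phi> P) / eval2 d (pmap \<phi> P)"
      "snd P = eval2 (snd n) (pmap \<phi> P) / eval2 d (pmap \<phi> P)" if "eval2 (pull \<phi> d) P \<noteq> 0" for P
      using left[of "pmap \<phi> P" P] that by (metis eval2_pull fst_conv, metis eval2_pull snd_conv)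
    show "xx * pull \<phi> d - pull \<phi> (fst n) = 0"
      by (rule eval2_zero_on_basic_open[OF nz]) (use P(1) in \<open>simp add: field_simps\<close>)
    show "yy * pull \<phi> d - pull \<phi> (snd n) = 0"
      by (rule eval2_zero_on_basic_open[OF nz]) (use P(2) in \<open>simp add: field_simps\<close>)
  qed
  hence "xx * pull \<phi> d = pull \<phi> (fst n)" "yy * pull \<phi> d = pull \<phi> (snd n)" by simp_all
  thus ?thesis unfolding birational_def using inj d0 by blast
qed

lemma birational_morphism_imp_birational:
  assumes "birational_morphism f"
  obtains \<phi> where "f = pmap \<phi>" "birational \<phi>"
  using rational_inverse_if_birational_morphism[OF assms] birational_if_rational_inverse by metis

section \<open>The group of automorphisms\<close>

lemma Aut_imp_birational_morphism:
  assumes "f \<in> Aut" shows "birational_morphism f"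
proof -
  have iso: "isomorphism UNIV UNIV f" using assms by (simp add: Aut_def)
  hence "morphism UNIV UNIV f" by (simp add: isomorphism_def)
  moreover have "zariski_open UNIV" using zariski_open_basic[of 1] by simp
  ultimately show ?thesis unfolding birational_morphism_def using iso by blast
qed

lemma Aut_comp: "f \<in> Aut \<Longrightarrow> g \<in> Aut \<Longrightarrow> f \<circ> g \<in> Aut"
proof -
  assume "f \<in> Aut" "g \<in> Aut"
  then obtain \<phi> \<phi>' \<psi> \<psi>' where f: "f = pmap \<phi>" "pmap \<phi>' \<circ> f = id" "f \<circ> pmap \<phi>' = id"
    and g: "g = pmap \<psi>" "pmap \<psi>' \<circ> g = id" "g \<circ> pmap \<psi>' = id" unfolding Aut_iff by blast
  have "f \<circ> g = pmap (pull \<psi> (fst \<phi>), pull \<psi> (snd \<phi>))" by (simp add: f(1) g(1) pmap_comp)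
  moreover have "pmap (pull \<phi>' (fst \<psi>'), pull \<phi>' (snd \<psi>')) = pmap \<psi>' \<circ> pmap \<phi>'" by (simp add: pmap_comp)
  moreover have "(pmap \<psi>' \<circ> pmap \<phi>') \<circ> (f \<circ> g) = id" "(f \<circ> g) \<circ> (pmap \<psi>' \<circ> pmap \<phi>') = id"
    using f(2,3) g(2,3) by (simp_all add: fun_eq_iff del: split_paired_All)
  ultimately show "f \<circ> g \<in> Aut" unfolding Aut_iff by metis
qed

lemma Aut_inverse:
  assumes "f \<in> Aut" shows "\<exists>g\<in>Aut. g \<circ> f = id \<and> f \<circ> g = id"
proof -
  obtain \<phi> \<psi> where f: "f = pmap \<phi>" "pmap \<psi> \<circ> f = id" "f \<circ> pmap \<psi> = id" using assms unfolding Aut_iff by blast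
  hence "pmap \<psi> \<in> Aut" unfolding Aut_iff by metis
  with f show ?thesis by metis
qed

lemma id_in_Aut: "(id :: 'a::alg_closed_field plane \<Rightarrow> 'a plane) \<in> Aut"
  unfolding Aut_iff by (intro exI[of _ "(xx, yy)"]) (simp add: pmap_id)

section \<open>Contracted curves\<close>

text \<open>The curve t = 0 is mapped to the point P. Written as a congruence, this also makes sense
  for composite t, such as the pullback of a contracted prime.\<close>

definition contracts :: "'a::alg_closed_field poly poly \<times> 'a poly poly \<Rightarrow> 'a poly poly \<Rightarrow> 'a plane \<Rightarrow> bool" where
  "contracts \<phi> t P \<longleftrightarrow> t dvd fst \<phi> - cst (fst P) \<and> t dvd snd \<phi> - cst (snd P)"

lemma contracts_dvd: "contracts \<phi> t P \<Longrightarrow> t dvd pull \<phi> q - cst (eval2 q P)"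
  using pull_cong_dvd_cst[of t \<phi> "fst P" "snd P" q] by (simp add: contracts_def)

text \<open>c splits into linear factors, and the prime t divides the value at F of one of
  them.\<close>

lemma prime_dvd_univariate:
  fixes t F :: "'a::alg_closed_field poly poly"
  assumes "prime_elem t" "c \<noteq> 0" "t dvd poly (map_poly cst c) F"
  obtains a where "t dvd F - cst a"
proof -
  have "\<exists>a. t dvd F - cst a" using assms(2,3)
  proof (induction "degree c" arbitrary: c)
    case 0
    then obtain a where a: "c = [:a:]" by (metis degree_eq_zeroE)
    hence "a \<noteq> 0" "t dvd cst a" using 0 by (auto simp: Polynomial.map_poly_pCons cst_def)
    hence "is_unit t" using is_unit_iff_cst dvd_unit_imp_unit by blast
    thus ?case using assms(1) by (simp add: prime_elem_def)
  next
    case (Suc n)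
    then obtain a where "poly c a = 0" by (metis alg_closed_imp_poly_has_root zero_less_Suc)
    then obtain c' where c': "c = [:-a, 1:] * c'" by (metis dvdE poly_eq_0_iff_dvd)
    have "c' \<noteq> 0" using c' Suc.prems by auto
    hence deg: "n = degree c'" using c' Suc.hyps(2) by (simp add: degree_mult_eq del: mult_pCons_left)
    have "poly (map_poly cst c) F = (F - cst a) * poly (map_poly cst c') F"
      unfolding c' by (rule eval2_eqI) (simp add: eval2_poly_map_cst algebra_simps)
    hence "t dvd F - cst a \<or> t dvd poly (map_poly cst c') F"
      using Suc.prems(2) assms(1) by (simp add: prime_elem_dvd_mult_iff)
    thus ?case using Suc.hyps(1)[OF deg \<open>c' \<noteq> 0\<close>] by blast
  qed
  thus ?thesis using that by blast
qed

text \<open>Take an element of the ideal \<open>(d, p)\<close> of minimal degree in \<open>y\<close>; pseudo-division shows that it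
  divides \<open>d\<close> and \<open>p\<close> up to factors in \<open>k[x]\<close>.\<close>
lemma ideal_contains_x_polynomial:
  fixes d p :: "'a::alg_closed_field poly poly"
  assumes d: "prime_elem d" and "\<not> d dvd p"
  obtains c a b where "c \<noteq> 0" "[:c:] = a * d + b * p"
proof -
  define I where "I = {a * d + b * p | a b. True}"
  have I_lin: "a * u + b * v \<in> I" if "u \<in> I" "v \<in> I" for a b u v
  proof -
    from that(1) obtain a1 b1 where 1: "u = a1 * d + b1 * p" unfolding I_def by blast
    from that(2) obtain a2 b2 where 2: "v = a2 * d + b2 * p" unfolding I_def by blast
    have "a * u + b * v = (a * a1 + b * a2) * d + (a * b1 + b * b2) * p" unfolding 1 2 by (simp add: algebra_simps)
    thus ?thesis unfolding I_def by blast
  qed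
  have dI: "d \<in> I" unfolding I_def by (intro CollectI exI[of _ 1] exI[of _ 0]) simp
  have pI: "p \<in> I" unfolding I_def by (intro CollectI exI[of _ 1] exI[of _ 0]) simp
  have d0: "d \<noteq> 0" using d by (simp add: prime_elem_def)
  define m where "m = arg_min degree (\<lambda>m. m \<in> I \<and> m \<noteq> 0)"
  have m: "m \<in> I" "m \<noteq> 0" and min: "\<And>u. u \<in> I \<Longrightarrow> u \<noteq> 0 \<Longrightarrow> degree m \<le> degree u"
    using arg_min_nat_lemma[of "\<lambda>m. m \<in> I \<and> m \<noteq> 0" d degree] dI d0 unfolding m_def by auto
  have div: "\<exists>c s. c \<noteq> 0 \<and> [:c:] * u = m * s" if u: "u \<in> I" for u
  proof -
    obtain q r where qr: "pseudo_divmod u m = (q, r)" by fastforce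
    define c where "c = lead_coeff m ^ (Suc (degree u) - degree m)"
    have eq: "smult c u = m * q + r" and r: "r = 0 \<or> degree r < degree m"
      using pseudo_divmod[OF m(2) qr] unfolding c_def by auto
    have "r = [:c:] * u + (- q) * m" using eq by (simp add: algebra_simps)
    hence "r \<in> I" using I_lin[OF u m(1), of "[:c:]" "- q"] by (simp only:)
    hence "r = 0" using min r by force
    hence "[:c:] * u = m * q" using eq by simp
    moreover have "c \<noteq> 0" using m(2) by (simp add: c_def)
    ultimately show ?thesis by blast
  qed
  have "degree m = 0"
  proof (rule ccontr)
    assume deg: "degree m \<noteq> 0"
    \<comment> \<open>A prime factor t of m of positive degree in y cannot divide the factor from
      k[x] left by pseudo-division, so it divides all of I. Then t is associated to d and divides p,
      a contradiction.\<close>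
    have key: "t dvd u" if t: "prime_elem t" "t dvd m" "degree t > 0" and u: "u \<in> I" for t u
    proof -
      obtain c s where c: "c \<noteq> 0" "[:c:] * u = m * s" using div[OF u] by blast
      have "t dvd [:c:] * u" unfolding c using t(2) by simp
      moreover have "\<not> t dvd [:c:]" using c(1) t(3) dvd_imp_degree_le[of t "[:c:]"] by auto
      ultimately show ?thesis using prime_elem_dvd_multD[OF t(1)] by blast
    qed
    have "\<exists>t. prime_elem t \<and> t dvd m' \<and> degree t > 0" if "degree m' \<noteq> 0" "m' \<noteq> 0" for m' :: "'a poly poly"
      using that
    proof (induction "bidegree m'" arbitrary: m' rule: less_induct)
      case less
      have "\<not> is_unit m'" using less.prems is_unit_iff_cst[of m'] by (auto simp: cst_def)
      then obtain t where t: "prime_elem t" "t dvd m'" using less.prems prime_factor_exists_poly by blast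
      then obtain s where s: "m' = t * s" by (auto simp: dvd_def)
      have nz: "t \<noteq> 0" "s \<noteq> 0" using s less.prems by auto
      show ?case
      proof (cases "degree t > 0")
        case False
        hence "degree s \<noteq> 0" using s less.prems nz by (simp add: degree_mult_eq)
        moreover have "bidegree s < bidegree m'"
          using s nz bidegree_mult[of t s] bidegree_eq_0_iff[of t] t(1) by (auto simp: prime_elem_def)
        ultimately obtain t' where "prime_elem t'" "t' dvd s" "degree t' > 0"
          using less.hyps[of s] nz(2) by blast
        thus ?thesis using s dvd_mult by blast
      qed (use t in blast)
    qed
    then obtain t where t: "prime_elem t" "t dvd m" "degree t > 0" using deg m(2) by blast
    have "t dvd d" "t dvd p" using key[OF t] dI pI by auto
    from this(1) obtain s where s: "d = t * s" by (auto simp: dvd_def)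
    have "\<not> is_unit t" using t(1) by (simp add: prime_elem_def)
    hence "is_unit s" using s d prime_elem_imp_irreducible irreducibleD by blast
    hence "d dvd t" unfolding s by (simp add: mult_unit_dvd_iff)
    thus False using \<open>t dvd p\<close> assms(2) dvd_trans by blast
  qed
  then obtain c where c: "m = [:c:]" by (metis degree_eq_zeroE)
  moreover from this have "c \<noteq> 0" using m(2) by simp
  ultimately show ?thesis using m(1) that unfolding I_def by blast
qed

text \<open>The curves d = 0 and p = 0 have no common component, so they meet in finitely many
  points, and the curve t = 0 is mapped into this intersection. The proof fixes the abscissa a first
  and then the ordinate on the line x = a.\<close>

lemma prime_contracted_if_dvd_two:
  assumes t: "prime_elem t" and d: "prime_elem d" and nd: "\<not> d dvd p"
    and td: "t dvd pull \<phi> d" and tp: "t dvd pull \<phi> p"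
  obtains P where "contracts \<phi> t P"
proof -
  obtain c u v where c: "c \<noteq> 0" "[:c:] = u * d + v * p"
    using ideal_contains_x_polynomial[OF d nd] by blast
  have pull_c: "pull \<phi> [:c:] = poly (map_poly cst c) (fst \<phi>)" for c
    by (rule eval2_eqI) (simp add: eval2_poly_map_cst)
  have "t dvd pull \<phi> [:c:]" using td tp by (simp add: c(2))
  then obtain a where a: "t dvd fst \<phi> - cst a"
    using prime_dvd_univariate[OF t c(1)] pull_c by metis
  \<comment> \<open>Modulo t the first coordinate may be replaced by a, which leaves a univariate
    polynomial in the second coordinate.\<close>
  have *: "\<exists>b. t dvd snd \<phi> - cst b" if q: "t dvd pull \<phi> q" "eval_x a q \<noteq> 0" for q
  proof -
    have "t dvd pull \<phi> q - pull (cst a, snd \<phi>) q" using pull_cong_dvd[of t \<phi> "(cst a, snd \<phi>)"] a by simp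
    from dvd_diff[OF q(1) this] have "t dvd pull (cst a, snd \<phi>) q" by simp
    also have "pull (cst a, snd \<phi>) q = poly (map_poly cst (eval_x a q)) (snd \<phi>)"
      by (rule eval2_eqI) (simp add: eval2_poly_map_cst pmap_def)
    finally show ?thesis using prime_dvd_univariate[OF t q(2)] by metis
  qed
  have xdvd: "xx - cst a dvd q" if "eval_x a q = 0" for q
  proof -
    have "[:-a, 1:] dvd coeff q i" for i
      using arg_cong[OF that, of "\<lambda>q. coeff q i"] by (simp add: poly_eq_0_iff_dvd)
    hence "[:[:-a, 1:]:] dvd q" by (simp add: const_poly_dvd_iff)
    moreover have "xx - cst a = [:[:-a, 1:]:]" by (simp add: xx_def cst_def)
    ultimately show ?thesis by simp
  qed
  \<comment> \<open>If both vanished on the line x = a, the prime d would be associated to x - a and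
    would divide p.\<close>
  have "eval_x a d \<noteq> 0 \<or> eval_x a p \<noteq> 0"
  proof (rule ccontr)
    assume "\<not> ?thesis"
    hence dv: "xx - cst a dvd d" "xx - cst a dvd p" using xdvd by auto
    then obtain s where s: "d = (xx - cst a) * s" by (auto simp: dvd_def)
    have "\<not> is_unit (xx - cst a)" 
      by (auto simp: is_unit_iff_cst xx_def cst_def)
    hence "is_unit s" using s d prime_elem_imp_irreducible irreducibleD by blast
    hence "d dvd xx - cst a" unfolding s by (simp add: mult_unit_dvd_iff)
    thus False using dv(2) nd dvd_trans by blast
  qed
  then obtain b where "t dvd snd \<phi> - cst b" using * td tp by blast
  with a that[of "(a, b)"] show ?thesis by (simp add: contracts_def)
qed

lemma birational_no_contraction_imp_Aut:
  assumes bir: "birational \<phi>" and nc: "\<And>t P. prime_elem t \<Longrightarrow> \<not> contracts \<phi> t P"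
  shows "pmap \<phi> \<in> Aut"
proof -
  have inj: "q = 0" if "pull \<phi> q = 0" for q using bir that unfolding birational_def by blast
  have poly: "\<exists>p. x = pull \<phi> p" if x: "x \<in> {xx, yy}" for x
  proof -
    obtain p0 q0 where pq0: "q0 \<noteq> 0" "x * pull \<phi> q0 = pull \<phi> p0"
      using bir x unfolding birational_def by blast
    obtain p q e where e: "p0 = e * p" "q0 = e * q" and
      red: "\<And>t. prime_elem t \<Longrightarrow> t dvd q \<Longrightarrow> \<not> t dvd p"
      using reduced_fraction[OF pq0(1)] by blast
    have nz: "e \<noteq> 0" "q \<noteq> 0" using pq0(1) e by auto
    have "pull \<phi> e * (x * pull \<phi> q) = pull \<phi> e * pull \<phi> p"
      using pq0(2) unfolding e by (simp add: algebra_simps)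
    hence pq: "x * pull \<phi> q = pull \<phi> p" using inj nz(1) by auto
    have "is_unit q"
    proof (rule ccontr)
      assume "\<not> is_unit q"
      with nz(2) obtain d where d: "prime_elem d" "d dvd q" using prime_factor_exists_poly by blast
      have nd: "\<not> d dvd p" using red d by blast
      have "\<not> is_unit (pull \<phi> d)"
      proof
        assume "is_unit (pull \<phi> d)"
        then obtain c where "c \<noteq> 0" "pull \<phi> d = cst c" using is_unit_iff_cst by blast
        hence "c \<noteq> 0" "d = cst c" using inj[of "d - cst c"] by auto
        hence "is_unit d" using is_unit_iff_cst by blast
        thus False using d(1) by (simp add: prime_elem_def)
      qed
      moreover have "pull \<phi> d \<noteq> 0" using inj[of d] d(1) by (auto simp: prime_elem_def)
      ultimately obtain t where t: "prime_elem t" "t dvd pull \<phi> d" using prime_factor_exists_poly by blast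
      have "t dvd pull \<phi> q" using t(2) pull_dvd[OF d(2)] dvd_trans by blast
      hence "t dvd pull \<phi> p" unfolding pq[symmetric] by simp
      thus False using prime_contracted_if_dvd_two[OF t(1) d(1) nd t(2)] nc[OF t(1)] by blast
    qed
    then obtain c where c: "c \<noteq> 0" "q = cst c" using is_unit_iff_cst by blast
    have "x = pull \<phi> (cst (inverse c) * p)"
    proof -
      have "pull \<phi> p = x * cst c" using pq by (simp add: c(2))
      thus ?thesis by (intro eval2_eqI) (simp add: c(1) del: eval2_pull)
    qed
    thus ?thesis by blast
  qed
  obtain p1 p2 where p: "xx = pull \<phi> p1" "yy = pull \<phi> p2" using poly by (metis insertI1 insertI2)
  define \<psi> where "\<psi> = (p1, p2)"
  have left: "pmap \<psi> \<circ> pmap \<phi> = id" by (simp add: pmap_comp \<psi>_def pmap_id flip: p)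
  \<comment> \<open>Injectivity of the comorphism of \<open>\<phi>\<close> turns this one-sided
    inverse into a two-sided one.\<close>
  have "pull \<phi> (pull \<psi> q) = q" for q by (simp add: pull_pull \<psi>_def pull_id flip: p)
  hence "pull \<psi> (fst \<phi>) = xx" "pull \<psi> (snd \<phi>) = yy"
    by (metis birational_pull_eq_iff[OF bir] pull_simps(10,11))+
  hence "pmap \<phi> \<circ> pmap \<psi> = id" by (simp add: pmap_comp pmap_id)
  with left show ?thesis unfolding Aut_iff by blast
qed

section \<open>A family of irreducible birational morphisms\<close>

text \<open>A polynomial of degree 1 in y factors only through a common divisor of its two
  coefficients; the Bezout relation makes that divisor a unit.\<close>

lemma irreducible_linear:
  fixes p q :: "'a::alg_closed_field poly"
  assumes "q \<noteq> 0" "u * p + v * q = [:c:]" "c \<noteq> 0"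
  shows "irreducible [:p, q:]"
proof (rule irreducibleI)
  show "[:p, q:] \<noteq> 0" using assms(1) by simp
  show "\<not> is_unit [:p, q:]" using assms(1) by (auto simp: is_unit_iff_cst cst_def)
  have const: "is_unit [:r:]" if "[:r:] dvd [:p, q:]" for r
  proof -
    have "r dvd coeff [:p, q:] 0" "r dvd coeff [:p, q:] 1" using that unfolding const_poly_dvd_iff by blast+
    hence "r dvd [:c:]" unfolding assms(2)[symmetric] by simp
    hence "is_unit r" using assms(3) dvd_unit_imp_unit is_unit_triv by blast
    thus ?thesis by simp
  qed
  fix a b assume ab: "[:p, q:] = a * b"
  hence nz: "a \<noteq> 0" "b \<noteq> 0" using assms(1) by auto
  have "degree [:p, q:] = 1" using assms(1) by simp
  hence "degree a = 0 \<or> degree b = 0" using degree_mult_eq[OF nz] unfolding ab by auto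
  thus "is_unit a \<or> is_unit b"
    using const ab by (metis degree_eq_zeroE dvd_triv_left dvd_triv_right)
qed

text \<open>The factor 1 / (l - 1), and the sign in \<open>e2\<close>, are chosen so that
  \<open>e1 l * e3 l\<close> is 1 on the curve \<open>e2\<close> and \<open>e1 l * e2\<close> is 1
  on the curve \<open>e3 l\<close>.\<close>

definition e1 :: "'a::alg_closed_field \<Rightarrow> 'a poly poly" where
  "e1 l = cst (1 / (l - 1)) * (cst l * yy + (1 + xx * yy) * (1 + cst l * (xx * yy)))"
definition e2 :: "'a::alg_closed_field poly poly" where
  "e2 = - (1 + xx + xx ^ 2 * yy)"
definition e3 :: "'a::alg_closed_field \<Rightarrow> 'a poly poly" where
  "e3 l = cst l + xx + cst l * xx ^ 2 * yy"
definition parabola :: "'a::alg_closed_field \<Rightarrow> 'a poly poly" where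
  "parabola l = (xx + cst l * yy) ^ 2 - (xx + cst (l ^ 2) * yy)"
definition family :: "'a::alg_closed_field \<Rightarrow> 'a poly poly \<times> 'a poly poly" where
  "family l = (e1 l * e3 l, e1 l * e2)"

text \<open>Associatedness in k[x,y], with the unit made explicit.\<close>

definition scalar_multiple :: "'a::alg_closed_field poly poly \<Rightarrow> 'a poly poly \<Rightarrow> bool" where
  "scalar_multiple p q \<longleftrightarrow> (\<exists>c. c \<noteq> 0 \<and> p = cst c * q)"

lemma scalar_multiple_sym: "scalar_multiple p q \<Longrightarrow> scalar_multiple q p"
  unfolding scalar_multiple_def
proof (elim exE conjE)
  fix c assume c: "c \<noteq> 0" "p = cst c * q"
  hence "q = cst (1 / c) * p" by (intro eval2_eqI) simp
  thus "\<exists>c. c \<noteq> 0 \<and> q = cst c * p" using c(1) by (metis divide_eq_0_iff zero_neq_one)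
qed

lemma scalar_multiple_if_dvd_irreducible:
  assumes "irreducible q" "p dvd q" "\<not> is_unit p" shows "scalar_multiple p q"
proof -
  obtain s where s: "q = p * s" using assms(2) by (auto simp: dvd_def)
  hence "is_unit s" using irreducibleD[OF assms(1) s] assms(3) by simp
  then obtain c where "c \<noteq> 0" "s = cst c" using is_unit_iff_cst by blast
  hence "scalar_multiple q p" using s unfolding scalar_multiple_def by (metis mult.commute)
  thus ?thesis by (rule scalar_multiple_sym)
qed

lemma scalar_multiple_dvd: "scalar_multiple p q \<Longrightarrow> q dvd r \<Longrightarrow> p dvd r"
  unfolding scalar_multiple_def using is_unit_iff_cst by (metis mult_unit_dvd_iff')

lemma not_dvd_if_zero:
  assumes "eval2 p P = 0" "eval2 q P \<noteq> 0" shows "\<not> p dvd q"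
  using assms by (auto simp: dvd_def)

lemma dvd_cst_imp: "t dvd cst (a :: 'a::alg_closed_field) \<Longrightarrow> \<not> is_unit t \<Longrightarrow> a = 0"
  using is_unit_iff_cst[of "cst a"] dvd_unit_imp_unit[of t "cst a"] by metis

text \<open>A divisor of x - a has degree 0 in y, so it divides each coefficient of the second
  polynomial, in particular the constant k.\<close>

lemma is_unit_if_dvd_two_lines:
  fixes t :: "'a::alg_closed_field poly poly"
  assumes "t dvd xx - cst a" "t dvd cst k * yy - cst b" "k \<noteq> 0"
  shows "is_unit t"
proof -
  have "t dvd [:[:-a, 1:]:]" using assms(1) by (simp add: xx_def cst_def)
  hence "degree t = 0" using dvd_imp_degree_le[of t "[:[:-a, 1:]:]"] by simp
  then obtain r where r: "t = [:r:]" by (metis degree_eq_zeroE)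
  have "t dvd [:[:-b:], [:k:]:]" using assms(2) by (simp add: yy_def cst_def)
  hence "r dvd coeff [:[:-b:], [:k:]:] 1" unfolding r const_poly_dvd_iff by blast
  hence "r dvd [:k:]" by simp
  hence "is_unit r" using dvd_unit_imp_unit[OF _ is_unit_triv[OF assms(3)]] by blast
  thus ?thesis by (simp add: r)
qed

lemma prime_xx: "prime_elem (xx :: 'a::alg_closed_field poly poly)"
proof -
  have "[:0, 1:] dvd p \<longleftrightarrow> poly p 0 = 0" for p :: "'a poly" using poly_eq_0_iff_dvd[of p 0] by simp
  hence "prime_elem [:0, 1 :: 'a:]" by (intro prime_elemI) auto
  thus ?thesis unfolding xx_def by (rule lift_prime_elem_poly)
qed

lemma prime_yy: "prime_elem (yy :: 'a::alg_closed_field poly poly)"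
proof -
  have "irreducible [:0, 1 :: 'a poly:]" by (rule irreducible_linear[of _ 0 _ 1 1]) simp_all
  thus ?thesis by (simp add: yy_def Unique_Factorization.ufd_class.prime_elem_iff_irreducible)
qed

section \<open>Equations of the exceptional curves\<close>

context
  fixes l :: "'a::alg_closed_field"
  assumes l: "l \<noteq> 0" "l \<noteq> 1"
begin

lemma l_simps [simp]: "l - 1 \<noteq> 0" "1 - l \<noteq> 0" using l by auto

lemma e1_pCons: "e1 l = [:[:1 / (l - 1):]:] * [:1, [:l, 1 + l:], [:0, 0, l:]:]"
  by (rule eval2_eqI) (simp add: e1_def algebra_simps power2_eq_square add_divide_distrib)

lemma e2_pCons: "e2 = [:[:-1, -1:], [:0, 0, -1 :: 'a:]:]"
  by (rule eval2_eqI) (simp add: e2_def algebra_simps power2_eq_square)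

lemma e3_pCons: "e3 l = [:[:l, 1:], [:0, 0, l:]:]"
  by (rule eval2_eqI) (simp add: e3_def algebra_simps power2_eq_square)

lemma irreducible_e2: "irreducible (e2 :: 'a poly poly)"
  \<comment> \<open>The Bezout relation is (1 - x)(-1 - x) - x^2 = -1.\<close>
  unfolding e2_pCons by (rule irreducible_linear[of _ "[:1, -1:]" _ "[:1:]" "-1"]) (simp_all, simp add: poly_eq_iff coeff_pCons split: nat.split)

lemma irreducible_e3: "irreducible (e3 l)"
  unfolding e3_pCons
  by (rule irreducible_linear[of _ "[:l, -1:]" _ "[:1 / l:]" "l ^ 2"]) (use l in \<open>simp_all add: power2_eq_square\<close>, simp add: poly_eq_iff coeff_pCons split: nat.split)

text \<open>Up to a unit this is 1 + (l + (1 + l) x) y + l x^2 y^2. Its constant term in y excludes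
  nonunit factors from k[x], so two proper factors are linear in y with constant terms in k. Their
  leading coefficients have product l x^2: degrees 2 and 0 would put x^2 into the coefficient of y,
  and degrees 1 and 1 would make that coefficient a multiple of x.\<close>

lemma irreducible_e1: "irreducible (e1 l)"
proof -
  define E where "E = [:1, [:l, 1 + l:], [:0, 0, l:]:]"
  have deg: "degree E = 2" using l by (simp add: E_def)
  have "irreducible E"
  proof (rule irreducibleI)
    show "E \<noteq> 0" using deg by auto
    show "\<not> is_unit E"
    proof
      assume "is_unit E"
      then obtain c where "E = cst c" using is_unit_iff_cst by blast
      thus False using deg by (simp add: cst_def)
    qed
    fix a b assume ab: "E = a * b"
    have const: "is_unit [:r:]" if "[:r:] dvd E" for r
    proof -
      have "r dvd coeff E 0" using that unfolding const_poly_dvd_iff by blast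
      thus ?thesis by (simp add: E_def)
    qed
    have nz: "a \<noteq> 0" "b \<noteq> 0" using ab deg by auto
    have sum: "degree a + degree b = 2" using degree_mult_eq[OF nz] deg ab by simp
    show "is_unit a \<or> is_unit b"
    proof (rule ccontr)
      assume nu: "\<not> ?thesis"
      have "degree a \<noteq> 0" using const[of "coeff a 0"] nu ab by (metis degree_eq_zeroE dvd_triv_left coeff_pCons_0)
      moreover have "degree b \<noteq> 0" using const[of "coeff b 0"] nu ab by (metis degree_eq_zeroE dvd_triv_right coeff_pCons_0)
      ultimately have "degree a = 1" "degree b = 1" using sum by auto
      then obtain a0 a1 b0 b1 where a: "a = [:a0, a1:]" and b: "b = [:b0, b1:]"
        by (metis degree1_coeffs)
      have eqs: "a0 * b0 = 1" "a0 * b1 + a1 * b0 = [:l, 1 + l:]" "a1 * b1 = [:0, 0, l:]"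
        using ab unfolding a b E_def by (auto simp: algebra_simps)
      have "a0 dvd a0 * b0" "b0 dvd a0 * b0" by (rule dvd_triv_left, rule dvd_triv_right)
      hence units: "is_unit a0" "is_unit b0" by (simp_all only: eqs(1))
      have nz0: "a0 \<noteq> 0" "b0 \<noteq> 0" using eqs(1) by (metis mult_zero_left zero_neq_one, metis mult_zero_right zero_neq_one)
      obtain \<alpha> where \<alpha>0: "a0 = [:\<alpha>:]" by (rule is_unit_polyE[OF units(1)])
      obtain \<beta> where \<beta>0: "b0 = [:\<beta>:]" by (rule is_unit_polyE[OF units(2)])
      have \<alpha>: "a0 = [:\<alpha>:]" "\<alpha> \<noteq> 0" and \<beta>: "b0 = [:\<beta>:]" "\<beta> \<noteq> 0"
        using nz0 by (simp_all add: \<alpha>0 \<beta>0)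
      have nz1: "a1 \<noteq> 0" "b1 \<noteq> 0" using eqs(3) l by auto
      have deg_sum: "degree a1 + degree b1 = 2" using degree_mult_eq[OF nz1] eqs(3) l by simp
      have eq2: "smult \<alpha> b1 + smult \<beta> a1 = [:l, 1 + l:]" using eqs(2) \<alpha> \<beta> by (simp add: mult.commute)
      have le: "degree [:l, 1 + l:] \<le> 1" by simp
      have "degree a1 \<noteq> 2"
      proof
        assume "degree a1 = 2"
        hence "degree (smult \<alpha> b1 + smult \<beta> a1) = 2"
          using deg_sum \<alpha> \<beta> by (subst degree_add_eq_right) auto
        thus False using le eq2 by simp
      qed
      moreover have "degree b1 \<noteq> 2"
      proof
        assume "degree b1 = 2"
        hence "degree (smult \<alpha> b1 + smult \<beta> a1) = 2"
          using deg_sum \<alpha> \<beta> by (subst degree_add_eq_left) auto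
        thus False using le eq2 by simp
      qed
      ultimately have "degree a1 = 1" "degree b1 = 1" using deg_sum by auto
      then obtain p0 p1 q0 q1 where p: "a1 = [:p0, p1:]" and q: "b1 = [:q0, q1:]"
        by (metis degree1_coeffs)
      have "p0 * q0 = 0" "p0 * q1 + p1 * q0 = 0" "p1 * q1 = l" "\<alpha> * q0 + \<beta> * p0 = l"
        using eqs(3) eq2 unfolding p q by (auto simp: algebra_simps)
      thus False using l by auto
    qed
  qed
  moreover have "is_unit [:[:1 / (l - 1):]:]" using l by simp
  ultimately show ?thesis unfolding e1_pCons E_def[symmetric] using irreducible_mult_unit_left by blast
qed

lemmas irreducible_e = irreducible_e1 irreducible_e2 irreducible_e3

lemma prime_e: "prime_elem (e1 l)" "prime_elem (e2 :: 'a poly poly)" "prime_elem (e3 l)"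
  using irreducible_e by (simp_all add: Unique_Factorization.ufd_class.prime_elem_iff_irreducible)

lemma not_unit_e: "\<not> is_unit (e1 l)" "\<not> is_unit (e2 :: 'a poly poly)" "\<not> is_unit (e3 l)"
  using prime_e by (simp_all add: prime_elem_def)

lemma e_nonzero: "e1 l \<noteq> 0" "(e2 :: 'a poly poly) \<noteq> 0" "e3 l \<noteq> 0"
  using prime_e by (auto simp: prime_elem_def)

lemma not_dvd_e:
  "\<not> e1 l dvd e2" "\<not> e1 l dvd e3 l" "\<not> e2 dvd e1 l" "\<not> e2 dvd e3 l" "\<not> e3 l dvd e1 l" "\<not> e3 l dvd e2"
proof -
  have *: "eval2 (e1 l) (0, - 1 / l) = 0" using l by (simp add: e1_def)
  show "\<not> e1 l dvd e2" "\<not> e1 l dvd e3 l"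
    by (rule not_dvd_if_zero[OF *]; use l in \<open>simp add: e2_def e3_def\<close>)+
  have *: "eval2 (e2 :: 'a poly poly) (- 1, 0) = 0" by (simp add: e2_def)
  show "\<not> e2 dvd e1 l" "\<not> e2 dvd e3 l"
    by (rule not_dvd_if_zero[OF *]; use l in \<open>simp add: e1_def e3_def\<close>)+
  have *: "eval2 (e3 l) (- l, 0) = 0" by (simp add: e3_def)
  show "\<not> e3 l dvd e1 l" "\<not> e3 l dvd e2"
    by (rule not_dvd_if_zero[OF *]; use l in \<open>simp add: e1_def e2_def\<close>)+
qed

lemma e_not_dvd_line:
  "\<not> e1 l dvd xx - cst a" "\<not> e2 dvd xx - cst a" "\<not> e3 l dvd xx - cst a"
proof -
  have x: "xx - cst a \<noteq> 0" "degree (xx - cst a) = 0" by (simp_all add: xx_def cst_def)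
  have "degree (e1 l) > 0" unfolding e1_pCons using l by (simp add: degree_mult_eq del: mult_pCons_left mult_pCons_right)
  moreover have "degree (e2 :: 'a poly poly) > 0" "degree (e3 l) > 0"
    unfolding e2_pCons e3_pCons using l by simp_all
  ultimately show "\<not> e1 l dvd xx - cst a" "\<not> e2 dvd xx - cst a" "\<not> e3 l dvd xx - cst a"
    using dvd_imp_degree_le[OF _ x(1)] x(2) by (metis not_gr_zero le_zero_eq)+
qed

lemma line_from_e: "e3 l + cst l * e2 = - (cst (l - 1) * xx)"
  by (rule eval2_eqI) (simp add: e2_def e3_def algebra_simps)

text \<open>With N and the coordinates as atoms, identities involving 1 / (l - 1) reduce to
  polynomial identities in l, w and z.\<close>

lemma eval2_eE:
  obtains N w z where "eval2 (e1 l) P = N / (l - 1)" "eval2 e2 P = - (1 + w + w ^ 2 * z)"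
    "eval2 (e3 l) P = l + w + l * w ^ 2 * z" "fst P = w" "snd P = z"
    "N = l * z + (1 + w * z) * (1 + l * (w * z))"
  by (rule that[of "l * snd P + (1 + fst P * snd P) * (1 + l * (fst P * snd P))" "fst P" "snd P"])
    (simp_all add: e1_def e2_def e3_def)

text \<open>In view of \<open>line_from_e\<close>, this is the pullback formula for the parabola
  divided by \<open>e1 l\<close>. It also recovers the value of \<open>e1 l\<close> from x,
  \<open>e2\<close> and \<open>e3 l\<close> when the rational inverse is checked.\<close>

lemma e1_line: "cst (l - 1) * e1 l * xx ^ 2 = - (e2 * e3 l) + cst (1 / (l - 1)) * (e3 l + cst (l ^ 2) * e2)"
proof (rule eval2_eqI)
  fix P :: "'a plane"
  obtain N w z where e: "eval2 (e1 l) P = N / (l - 1)" "eval2 e2 P = - (1 + w + w ^ 2 * z)"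
    "eval2 (e3 l) P = l + w + l * w ^ 2 * z" and P: "fst P = w" "snd P = z"
    and N: "N = l * z + (1 + w * z) * (1 + l * (w * z))" by (rule eval2_eE)
  have div: "x = y + u / c" if "c * x = c * y + u" "c \<noteq> 0" for x y u c :: 'a
    using that by (simp add: field_simps)
  have fin: "c * (x / c) * v = - (- y * u) + 1 / c * (u + d * - y)"
    if "x * v = y * u + (u - d * y) / c" "c \<noteq> 0" for x y u v c d :: 'a
    using that by (simp add: field_simps)
  have "(l - 1) * (N * w ^ 2) = (l - 1) * ((1 + w + w ^ 2 * z) * (l + w + l * w ^ 2 * z))
      + ((l + w + l * w ^ 2 * z) - l ^ 2 * (1 + w + w ^ 2 * z))"
    unfolding N by (simp add: algebra_simps power2_eq_square)
  hence "N * w ^ 2 = (1 + w + w ^ 2 * z) * (l + w + l * w ^ 2 * z)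
      + ((l + w + l * w ^ 2 * z) - l ^ 2 * (1 + w + w ^ 2 * z)) / (l - 1)"
    using l_simps(1) by (rule div)
  thus "eval2 (cst (l - 1) * e1 l * xx ^ 2) P =
    eval2 (- (e2 * e3 l) + cst (1 / (l - 1)) * (e3 l + cst (l ^ 2) * e2)) P"
    unfolding eval2_simps e P using l_simps(1) by (rule fin)
qed

lemma pull_family [simp]:
  "pull (family l) xx = e1 l * e3 l" "pull (family l) yy = e1 l * e2"
  by (simp_all add: family_def)

lemma pull_family_parabola: "pull (family l) (parabola l) = - (cst (l - 1) * e1 l * e2 * e3 l)"
proof -
  have "pull (family l) (parabola l) = e1 l * (e1 l * (e3 l + cst l * e2) ^ 2 - (e3 l + cst (l ^ 2) * e2))"
    by (simp add: parabola_def family_def algebra_simps power2_eq_square)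
  also have "\<dots> = e1 l * (cst (l - 1) * (cst (l - 1) * e1 l * xx ^ 2) - (e3 l + cst (l ^ 2) * e2))"
    unfolding line_from_e by (simp add: algebra_simps power2_eq_square)
  also have "\<dots> = - (cst (l - 1) * e1 l * e2 * e3 l)"
    unfolding e1_line by (rule eval2_eqI) (use l in \<open>simp add: field_simps\<close>)
  finally show ?thesis .
qed

lemma family_contracts:
  "contracts (family l) (e1 l) (0, 0)" "contracts (family l) e2 (1, 0)" "contracts (family l) (e3 l) (0, 1)"
proof -
  have 0: "cst 0 = (0 :: 'a poly poly)" by (simp add: cst_def)
  show "contracts (family l) (e1 l) (0, 0)" by (simp add: contracts_def family_def 0)
  have "e1 l * e3 l - cst 1 = e2 * (1 + cst l * (xx * yy) - cst l * e1 l)"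
  proof (rule eval2_eqI)
    fix P :: "'a plane"
    obtain N w z where e: "eval2 (e1 l) P = N / (l - 1)" "eval2 e2 P = - (1 + w + w ^ 2 * z)"
      "eval2 (e3 l) P = l + w + l * w ^ 2 * z" and P: "fst P = w" "snd P = z"
      and N: "N = l * z + (1 + w * z) * (1 + l * (w * z))" by (rule eval2_eE)
    \<comment> \<open>The claimed factorization multiplied by l - 1, with the quotient by
      \<open>e2\<close> written out.\<close>
    have "N * (l + w + l * w ^ 2 * z) - (l - 1) = - (1 + w + w ^ 2 * z) * ((l - 1) * (1 + l * (w * z)) - l * N)"
      unfolding N by (simp add: algebra_simps power2_eq_square)
    from arg_cong[OF this, of "\<lambda>x. x / (l - 1)"]
    show "eval2 (e1 l * e3 l - cst 1) P = eval2 (e2 * (1 + cst l * (xx * yy) - cst l * e1 l)) P"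
      using l_simps(1) by (simp only: eval2_simps e P) (simp add: diff_divide_distrib right_diff_distrib mult.commute)
  qed
  thus "contracts (family l) e2 (1, 0)" by (simp add: contracts_def family_def 0)
  have "e1 l * e2 - cst 1 = e3 l * (cst (- 1 / l) * (1 + xx * yy + e1 l))"
  proof (rule eval2_eqI)
    fix P :: "'a plane"
    obtain N w z where e: "eval2 (e1 l) P = N / (l - 1)" "eval2 e2 P = - (1 + w + w ^ 2 * z)"
      "eval2 (e3 l) P = l + w + l * w ^ 2 * z" and P: "fst P = w" "snd P = z"
      and N: "N = l * z + (1 + w * z) * (1 + l * (w * z))" by (rule eval2_eE)
    have "l * (N * - (1 + w + w ^ 2 * z) - (l - 1)) = - ((l + w + l * w ^ 2 * z) * ((l - 1) * (1 + w * z) + N))"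
      unfolding N by (simp add: algebra_simps power2_eq_square)
    moreover have "x / c * - y - 1 = u * (- 1 / l * (1 + v + x / c))"
      if "l * (x * - y - c) = - (u * (c * (1 + v) + x))" "c \<noteq> 0" for x y u v c
    proof -
      have "l * c * (x / c * - y - 1) = l * c * (u * (- 1 / l * (1 + v + x / c)))"
        using that l(1) by (simp add: field_simps)
      moreover have "l * c \<noteq> 0" using that(2) l(1) by simp
      ultimately show ?thesis using mult_left_cancel[of "l * c"] by blast
    qed
    ultimately show "eval2 (e1 l * e2 - cst 1) P = eval2 (e3 l * (cst (- 1 / l) * (1 + xx * yy + e1 l))) P"
      unfolding eval2_simps e P using l_simps(1) by blast
  qed
  thus "contracts (family l) (e3 l) (0, 1)" by (simp add: contracts_def family_def 0)
qed

end

section \<open>Curves contracted by the family\<close>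

context
  fixes l :: "'a::alg_closed_field"
  assumes l: "l \<noteq> 0" "l \<noteq> 1"
begin

text \<open>Otherwise e1 e3, e1 e2 and, through the parabola, e1 e2 e3 are nonzero constants modulo
  \<open>\<pi>\<close>. Quotients make e2 and e3 constant, hence x by \<open>line_from_e\<close>,
  and finally y, which is impossible on a curve.\<close>

lemma prime_contracted_dvd_e:
  assumes \<pi>: "prime_elem \<pi>" and c: "contracts (family l) \<pi> P"
  shows "\<pi> dvd e1 l \<or> \<pi> dvd e2 \<or> \<pi> dvd e3 l"
proof (rule ccontr)
  assume not: "\<not> ?thesis"
  obtain a b where P: "P = (a, b)" by fastforce
  have nu: "\<not> is_unit \<pi>" using \<pi> by (simp add: prime_elem_def)
  have A: "\<pi> dvd e1 l * e3 l - cst a" and B: "\<pi> dvd e1 l * e2 - cst b"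
    using c by (simp_all add: contracts_def family_def P)
  have no_prod: "\<not> \<pi> dvd e1 l * e3 l" "\<not> \<pi> dvd e1 l * e2" "\<not> \<pi> dvd e1 l * e3 l * e2"
    using not \<pi> by (auto simp: prime_elem_dvd_mult_iff)
  define d where "d = - eval2 (parabola l) P / (l - 1)"
  have "\<pi> dvd cst (- 1 / (l - 1)) * (pull (family l) (parabola l) - cst (eval2 (parabola l) P))"
    using contracts_dvd[OF c] by (rule dvd_mult)
  also have "\<dots> = e1 l * e3 l * e2 - cst d"
    unfolding pull_family_parabola[OF l] d_def by (rule eval2_eqI) (use l in \<open>simp add: field_simps\<close>)
  finally have D: "\<pi> dvd e1 l * e3 l * e2 - cst d" .
  have nz: "x \<noteq> 0" if "\<pi> dvd q - cst x" "\<not> \<pi> dvd q" for q x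
    using that by (auto simp: cst_def)
  have ab: "a \<noteq> 0" "b \<noteq> 0" "d \<noteq> 0" using nz[OF A] nz[OF B] nz[OF D] no_prod by auto
  have quot: "\<pi> dvd q - cst (d / x)" if "\<pi> dvd p - cst x" "\<pi> dvd p * q - cst d" "x \<noteq> 0" for p q x
  proof -
    have "\<pi> dvd cst (1 / x) * ((p * q - cst d) - (p - cst x) * q)" using that by (simp add: dvd_diff)
    also have "\<dots> = q - cst (d / x)"
      by (rule eval2_eqI) (use that(3) in \<open>simp add: field_simps\<close>)
    finally show ?thesis .
  qed
  have E2: "\<pi> dvd e2 - cst (d / a)" by (rule quot[OF A D ab(1)])
  have "\<pi> dvd (e1 l * e2) * e3 l - cst d" using D by (simp add: mult_ac)
  hence E3: "\<pi> dvd e3 l - cst (d / b)" by (rule quot[OF B _ ab(2)])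
  define w0 where "w0 = - (d / b + l * (d / a)) / (l - 1)"
  have "\<pi> dvd cst (- 1 / (l - 1)) * ((e3 l - cst (d / b)) + cst l * (e2 - cst (d / a)))"
    using E2 E3 by simp
  also have "\<dots> = cst (- 1 / (l - 1)) * ((e3 l + cst l * e2) - cst (d / b + l * (d / a)))"
    by (rule eval2_eqI) (simp add: algebra_simps)
  also have "\<dots> = xx - cst w0"
    unfolding line_from_e[OF l] w0_def by (rule eval2_eqI) (use l in \<open>simp add: field_simps\<close>)
  finally have W: "\<pi> dvd xx - cst w0" .
  have restrict: "\<pi> dvd pull (cst w0, yy) q - cst x" if "\<pi> dvd q - cst x" for q x
  proof -
    have "\<pi> dvd pull (xx, yy) q - pull (cst w0, yy) q" by (rule pull_cong_dvd) (use W in simp_all)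
    from dvd_diff[OF that this] show ?thesis by (simp add: pull_id)
  qed
  \<comment> \<open>On x = w0 with w0 \<noteq> 0, \<open>e2\<close> is linear in y with slope -w0^2.
    On x = 0 it is constant, but there \<open>e1 l\<close> has slope l / (l - 1).\<close>
  show False
  proof (cases "w0 = 0")
    case False
    have "\<pi> dvd pull (cst w0, yy) e2 - cst (d / a)" by (rule restrict[OF E2])
    hence "\<pi> dvd - (pull (cst w0, yy) e2 - cst (d / a))" by (simp only: dvd_minus_iff)
    also have "- (pull (cst w0, yy) e2 - cst (d / a)) = cst (w0 ^ 2) * yy - cst (- (1 + w0 + d / a))"
      by (rule eval2_eqI) (simp add: e2_def)
    finally have Y: "\<pi> dvd cst (w0 ^ 2) * yy - cst (- (1 + w0 + d / a))" .
    show False using is_unit_if_dvd_two_lines[OF W Y] nu False by simp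
  next
    case True
    have "\<pi> dvd cst (d / a) * e1 l - cst b"
    proof -
      have "\<pi> dvd (e1 l * e2 - cst b) - e1 l * (e2 - cst (d / a))" using B E2 by (simp add: dvd_diff)
      thus ?thesis by (simp add: algebra_simps)
    qed
    from restrict[OF this]
    have "\<pi> dvd pull (cst 0, yy) (cst (d / a) * e1 l) - cst b" by (simp add: True)
    also have "pull (cst 0, yy) (cst (d / a) * e1 l) - cst b =
        cst (d / a * (1 / (l - 1)) * l) * yy - cst (b - d / a * (1 / (l - 1)))"
      by (rule eval2_eqI) (simp add: e1_def pmap_def algebra_simps)
    finally have Y: "\<pi> dvd cst (d / a * (1 / (l - 1)) * l) * yy - cst (b - d / a * (1 / (l - 1)))" .
    show False using is_unit_if_dvd_two_lines[OF W Y] nu ab l by simp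
  qed
qed

lemma dvd_e_cases:
  assumes "contracts (family l) \<pi> P" "\<not> is_unit \<pi>"
  shows "\<pi> dvd e1 l \<Longrightarrow> P = (0, 0)" "\<pi> dvd e2 \<Longrightarrow> P = (1, 0)" "\<pi> dvd e3 l \<Longrightarrow> P = (0, 1)"
proof -
  have eq: "P = Q" if "\<pi> dvd e" "contracts (family l) e Q" for e Q
  proof -
    have "cst (fst Q) - cst (fst P) = (fst (family l) - cst (fst P)) - (fst (family l) - cst (fst Q))"
      "cst (snd Q) - cst (snd P) = (snd (family l) - cst (snd P)) - (snd (family l) - cst (snd Q))" by simp_all
    hence "\<pi> dvd cst (fst Q) - cst (fst P)" "\<pi> dvd cst (snd Q) - cst (snd P)"
      using assms(1) that dvd_trans[OF that(1)] by (metis contracts_def dvd_diff)+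
    hence "\<pi> dvd cst (fst Q - fst P)" "\<pi> dvd cst (snd Q - snd P)" by (simp_all add: cst_def)
    thus ?thesis using dvd_cst_imp assms(2) by (metis eq_iff_diff_eq_0 prod_eqI)
  qed
  show "\<pi> dvd e1 l \<Longrightarrow> P = (0, 0)" "\<pi> dvd e2 \<Longrightarrow> P = (1, 0)" "\<pi> dvd e3 l \<Longrightarrow> P = (0, 1)"
    by (rule eq; use family_contracts[OF l] in simp)+
qed

lemma contracts_dvd_trans: "contracts \<phi> t P \<Longrightarrow> s dvd t \<Longrightarrow> contracts \<phi> s P"
  unfolding contracts_def using dvd_trans by blast

text \<open>Every prime factor of T is associated to the same e_i, which the point P determines. It
  occurs only once, because T divides \<open>e1 l * e3 l\<close> or \<open>e1 l * e2\<close>.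
  Composite T must be allowed since T will be the pullback of a prime.\<close>

lemma contracted_by_family:
  assumes T: "T \<noteq> 0" "\<not> is_unit T" and c: "contracts (family l) T P"
  shows "P = (0, 0) \<and> scalar_multiple T (e1 l) \<or> P = (1, 0) \<and> scalar_multiple T e2 \<or>
    P = (0, 1) \<and> scalar_multiple T (e3 l)"
proof -
  have factor: "P = (0, 0) \<and> e1 l dvd S \<or> P = (1, 0) \<and> e2 dvd S \<or> P = (0, 1) \<and> e3 l dvd S"
    if S: "S dvd T" "\<not> is_unit S" for S
  proof -
    have "S \<noteq> 0" using S T by auto
    then obtain \<pi> where \<pi>: "prime_elem \<pi>" "\<pi> dvd S" using prime_factor_exists_poly S(2) by blast
    have c': "contracts (family l) \<pi> P" using contracts_dvd_trans[OF c] S(1) \<pi>(2) dvd_trans by blast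
    have nu: "\<not> is_unit \<pi>" using \<pi>(1) by (simp add: prime_elem_def)
    have conv: "e dvd S" if "\<pi> dvd e" "irreducible e" for e
      by (rule scalar_multiple_dvd[OF scalar_multiple_sym[OF scalar_multiple_if_dvd_irreducible[OF that(2,1) nu]] \<pi>(2)])
    show ?thesis
      using prime_contracted_dvd_e[OF \<pi>(1) c'] dvd_e_cases[OF c' nu] conv irreducible_e[OF l] by metis
  qed
  have fin: "scalar_multiple T e" if "e dvd T" "\<not> e * e dvd T" and sing: "\<And>S. S dvd T \<Longrightarrow> \<not> is_unit S \<Longrightarrow> e dvd S" for e
  proof -
    from that(1) obtain S where S: "T = e * S" by (auto simp: dvd_def)
    have "is_unit S"
    proof (rule ccontr)
      assume "\<not> is_unit S"
      hence "e dvd S" using sing[of S] S by simp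
      thus False using that(2) S by (simp add: mult_dvd_mono)
    qed
    then obtain c where "c \<noteq> 0" "S = cst c" using is_unit_iff_cst by blast
    thus ?thesis using S unfolding scalar_multiple_def by (metis mult.commute)
  qed
  consider "P = (0, 0)" "e1 l dvd T" | "P = (1, 0)" "e2 dvd T" | "P = (0, 1)" "e3 l dvd T"
    using factor[of T] T(2) by auto
  thus ?thesis
  proof cases
    case 1
    have "T dvd e1 l * e3 l" using c by (simp add: contracts_def family_def 1 cst_def)
    hence "\<not> e1 l * e1 l dvd T"
      using not_dvd_e(2)[OF l] e_nonzero[OF l] dvd_trans[of "e1 l * e1 l" T "e1 l * e3 l"] by auto
    moreover have "\<And>S. S dvd T \<Longrightarrow> \<not> is_unit S \<Longrightarrow> e1 l dvd S" using factor 1 by auto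
    ultimately show ?thesis using fin 1 by blast
  next
    case 2
    have "T dvd e2 * e1 l" using c by (simp add: contracts_def family_def 2 cst_def mult.commute)
    hence "\<not> e2 * e2 dvd T"
      using not_dvd_e(3)[OF l] e_nonzero[OF l] dvd_trans[of "e2 * e2" T "e2 * e1 l"] by auto
    moreover have "\<And>S. S dvd T \<Longrightarrow> \<not> is_unit S \<Longrightarrow> e2 dvd S" using factor 2 by auto
    ultimately show ?thesis using fin 2 by blast
  next
    case 3
    have "T dvd e3 l * e1 l" using c by (simp add: contracts_def family_def 3 cst_def mult.commute)
    hence "\<not> e3 l * e3 l dvd T"
      using not_dvd_e(5)[OF l] e_nonzero[OF l] dvd_trans[of "e3 l * e3 l" T "e3 l * e1 l"] by auto
    moreover have "\<And>S. S dvd T \<Longrightarrow> \<not> is_unit S \<Longrightarrow> e3 l dvd S" using factor 3 by auto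
    ultimately show ?thesis using fin 3 by blast
  qed
qed

end

section \<open>Irreducibility of the family\<close>

context
  fixes l :: "'a::alg_closed_field"
  assumes l: "l \<noteq> 0" "l \<noteq> 1"
begin

lemma xx_not_const_mod_contracted:
  assumes "contracts (family l) T P" "\<not> is_unit T" "T \<noteq> 0"
  shows "\<not> T dvd xx - cst c"
proof
  assume "T dvd xx - cst c"
  moreover have "scalar_multiple T (e1 l) \<or> scalar_multiple T e2 \<or> scalar_multiple T (e3 l)"
    using contracted_by_family[OF l assms(3,2,1)] by blast
  ultimately show False using e_not_dvd_line[OF l] scalar_multiple_sym scalar_multiple_dvd by metis
qed

lemma xx_not_in_range_pull_family: "xx \<noteq> pull (family l) q"
proof
  assume "xx = pull (family l) q"
  hence "e1 l dvd xx - cst (eval2 q (0, 0))"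
    using contracts_dvd[OF family_contracts(1)[OF l]] by metis
  thus False using e_not_dvd_line[OF l] by blast
qed

lemma family_not_Aut: "pmap (family l) \<notin> Aut"
proof
  assume "pmap (family l) \<in> Aut"
  then obtain \<psi> where "pmap \<psi> \<circ> pmap (family l) = id" unfolding Aut_iff by blast
  hence "(pull (family l) (fst \<psi>), pull (family l) (snd \<psi>)) = (xx, yy)"
    unfolding pmap_comp by (intro pmap_inject) (simp add: pmap_id)
  thus False using xx_not_in_range_pull_family by (metis prod.inject)
qed

lemma family_irreducible:
  assumes g: "birational g" and h: "birational h" and gh: "pmap (family l) = pmap g \<circ> pmap h"
  shows "pmap g \<in> Aut \<or> pmap h \<in> Aut"
proof (rule ccontr)
  assume "\<not> ?thesis"
  then obtain t P t' P' where t: "prime_elem t" "contracts g t P" and t': "prime_elem t'" "contracts h t' P'"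
    using birational_no_contraction_imp_Aut[OF g] birational_no_contraction_imp_Aut[OF h] by blast
  have family_eq: "family l = (pull h (fst g), pull h (snd g))" using gh unfolding pmap_comp by (rule pmap_inject)
  have pull_gh: "pull h (pull g q) = pull (family l) q" for q by (simp add: pull_pull family_eq)
  note inj = birational_pull_eq_iff[OF h]
  \<comment> \<open>The aim is to place \<open>e2\<close> and \<open>e3 l\<close>, and thereby x, in
    the image R of the comorphism of h.\<close>
  define R where "R = range (pull h)"
  have R_scale: "q \<in> R" if "cst c * q \<in> R" "c \<noteq> 0" for c q
  proof -
    from that(1) obtain r where "cst c * q = pull h r" unfolding R_def by auto
    hence "pull h (cst (1 / c) * r) = cst (1 / c) * (cst c * q)" by simp
    also have "\<dots> = q" using that(2) by (intro eval2_eqI) simp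
    finally show ?thesis unfolding R_def by (metis rangeI)
  qed
  have R_similar: "e \<in> R" if "scalar_multiple q e" "q \<in> R" for q e
    using that R_scale unfolding scalar_multiple_def by blast
  \<comment> \<open>If s divides q and pulls back to e up to a constant, then the cofactor of e in
    the pullback of q comes from h as well.\<close>
  have quot: "m \<in> R" if "s dvd q" "scalar_multiple (pull h s) e" "pull h q = e * m" "e \<noteq> 0" for s q e m
  proof -
    from that(1) obtain r where r: "q = s * r" by (auto simp: dvd_def)
    from that(2) obtain c where c: "c \<noteq> 0" "pull h s = cst c * e" unfolding scalar_multiple_def by blast
    have "e * (cst c * pull h r) = e * m" using that(3) by (simp add: r c mult_ac)
    hence "m = pull h (cst c * r)" using that(4) by simp
    thus ?thesis unfolding R_def by blast
  qed
  \<comment> \<open>The pullback under h of a prime contracted by g is contracted by the whole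
    composite, so it is one of the e_i up to a constant.\<close>
  have contr: "P = (0, 0) \<and> scalar_multiple (pull h t) (e1 l) \<or> P = (1, 0) \<and> scalar_multiple (pull h t) e2 \<or>
      P = (0, 1) \<and> scalar_multiple (pull h t) (e3 l)" if t: "prime_elem t" "contracts g t P" for t P
  proof (rule contracted_by_family[OF l])
    show "pull h t \<noteq> 0" using inj[of t 0] t(1) by (auto simp: prime_elem_def)
    show "\<not> is_unit (pull h t)"
    proof
      assume "is_unit (pull h t)"
      then obtain c where c: "c \<noteq> 0" "pull h t = cst c" using is_unit_iff_cst by blast
      hence "t = cst c" using inj[of t "cst c"] by simp
      hence "is_unit t" using c(1) is_unit_iff_cst by blast
      thus False using t(1) by (simp add: prime_elem_def)
    qed
    have "pull h t dvd pull h (fst g - cst (fst P))" "pull h t dvd pull h (snd g - cst (snd P))"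
      using t(2) unfolding contracts_def by (blast intro: pull_dvd)+
    thus "contracts (family l) (pull h t) P" unfolding contracts_def family_eq by simp
  qed
  have zero: "cst 0 = (0 :: 'a poly poly)" by (simp add: cst_def)
  have dvd_pull: "t dvd pull g q" if "eval2 q P = 0" for q
    using contracts_dvd[OF t(2), of q] that by (simp add: zero)
  have Dx: "pull h (pull g xx) = e1 l * e3 l" and Dy: "pull h (pull g yy) = e1 l * e2"
    by (simp_all only: pull_gh pull_family[OF l])
  \<comment> \<open>A second contracted prime: t divides the pullback of the parabola under g, and
    comparison after pulling back by h shows that the cofactor s is a constant multiple of
    \<open>pull g q\<close>. A prime factor of \<open>pull g q\<close> therefore divides the
    pullbacks of both q and the parabola.\<close>
  have other: "\<exists>\<rho> P. prime_elem \<rho> \<and> \<rho> dvd pull g q \<and> contracts g \<rho> P"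
    if q: "prime_elem q" "\<not> q dvd parabola l" "pull h (pull g q) = e1 l * m" 
      and T: "scalar_multiple (pull h t) e" "e1 l * m * e = e1 l * e2 * e3 l" "e \<noteq> 0" "eval2 (parabola l) P = 0"
    for q e m
  proof -
    have mz: "e1 l * m \<noteq> 0" using T(2) e_nonzero[OF l] by auto
    have nz: "pull g q \<noteq> 0" using q(3) mz by auto
    have nu: "\<not> is_unit (pull g q)"
    proof
      assume "is_unit (pull g q)"
      then obtain c where c: "c \<noteq> 0" "pull g q = cst c" using is_unit_iff_cst by blast
      hence "is_unit (e1 l * m)" using q(3) is_unit_iff_cst by (metis pull_simps(9))
      thus False using not_unit_e[OF l] by (simp add: is_unit_mult_iff)
    qed
    obtain \<rho> where \<rho>: "prime_elem \<rho>" "\<rho> dvd pull g q" using prime_factor_exists_poly[OF nz nu] by blast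
    obtain s where s: "pull g (parabola l) = t * s" using dvd_pull[OF T(4)] by (auto simp: dvd_def)
    obtain c where c: "c \<noteq> 0" "pull h t = cst c * e" using T(1) unfolding scalar_multiple_def by blast
    have "e * (cst c * pull h s) = pull h (pull g (parabola l))" by (simp add: s c mult_ac)
    also have "\<dots> = - (cst (l - 1) * (e1 l * e2 * e3 l))" by (simp add: pull_gh pull_family_parabola[OF l] mult_ac)
    also have "\<dots> = e * (- cst (l - 1) * (e1 l * m))" unfolding T(2)[symmetric] by (simp add: mult_ac)
    finally have "cst c * pull h s = - cst (l - 1) * (e1 l * m)" by (rule mult_left_cancel[OF T(3), THEN iffD1])
    hence "pull h (cst c * s) = pull h (- cst (l - 1) * pull g q)" by (simp add: q(3))
    hence "cst c * s = - cst (l - 1) * pull g q" by (simp only: inj)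
    hence "\<rho> dvd cst c * s" using \<rho>(2) by simp
    moreover have "is_unit (cst c)" using c(1) is_unit_iff_cst by blast
    ultimately have "\<rho> dvd s" by (simp add: dvd_mult_unit_iff')
    hence "\<rho> dvd pull g (parabola l)" unfolding s by simp
    thus ?thesis using prime_contracted_if_dvd_two[OF \<rho>(1) q(1,2) \<rho>(2)] \<rho> by metis
  qed
  have R_pull: "pull h q \<in> R" for q unfolding R_def by blast
  have pull_h_dvd: "e dvd q" if "scalar_multiple (pull h \<rho>) e" "\<rho> dvd r" "pull h r = q" for e \<rho> r q
    using scalar_multiple_dvd[OF scalar_multiple_sym[OF that(1)] pull_dvd[OF that(2)]] that(3) by simp
  note not_dvd_e' = not_dvd_e[OF l] prime_e[OF l]
  have all: "e2 \<in> R \<and> e3 l \<in> R"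
  proof -
    consider "P = (0, 0)" "scalar_multiple (pull h t) (e1 l)" | "P = (1, 0)" "scalar_multiple (pull h t) e2"
      | "P = (0, 1)" "scalar_multiple (pull h t) (e3 l)" using contr[OF t] by blast
    thus ?thesis
    proof cases
      case 1
      \<comment> \<open>Both coordinate lines pass through (0,0), so e1 can be divided out of e1 e3
        and of e1 e2 inside R.\<close>
      have "t dvd pull g xx" "t dvd pull g yy" by (rule dvd_pull; simp add: 1(1))+
      thus ?thesis using quot[OF _ 1(2) Dx] quot[OF _ 1(2) Dy] e_nonzero[OF l] by blast
    next
      case 2
      have e2R: "e2 \<in> R" using R_similar[OF 2(2) R_pull] .
      have "\<not> xx dvd parabola l"
        by (rule not_dvd_if_zero[of _ "(0, l)"]) (use l in \<open>simp_all add: parabola_def power2_eq_square\<close>)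
      then obtain \<rho> Q where \<rho>: "prime_elem \<rho>" "\<rho> dvd pull g xx" "contracts g \<rho> Q"
        using other[OF prime_xx _ Dx 2(2)] e_nonzero[OF l] 2(1) by (auto simp: parabola_def mult_ac)
      have "\<not> scalar_multiple (pull h \<rho>) e2"
        using pull_h_dvd[OF _ \<rho>(2) Dx] not_dvd_e' by (metis prime_elem_dvd_mult_iff)
      then consider "scalar_multiple (pull h \<rho>) (e1 l)" | "scalar_multiple (pull h \<rho>) (e3 l)"
        using contr[OF \<rho>(1,3)] by blast
      \<comment> \<open>If \<open>\<rho>\<close> pulls back to e1, then e3 is the cofactor in e1 e3;
        otherwise \<open>\<rho>\<close> pulls back to e3 itself.\<close>
      hence "e3 l \<in> R"
        by cases (use quot[OF \<rho>(2) _ Dx] e_nonzero[OF l] R_similar[OF _ R_pull] in blast)+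
      thus ?thesis using e2R by blast
    next
      case 3
      have e3R: "e3 l \<in> R" using R_similar[OF 3(2) R_pull] .
      have "\<not> yy dvd parabola l"
        by (rule not_dvd_if_zero[of _ "(l, 0)"]) (use l in \<open>simp_all add: parabola_def power2_eq_square\<close>)
      then obtain \<rho> Q where \<rho>: "prime_elem \<rho>" "\<rho> dvd pull g yy" "contracts g \<rho> Q"
        using other[OF prime_yy _ Dy 3(2)] e_nonzero[OF l] 3(1) by (auto simp: parabola_def mult_ac)
      have "\<not> scalar_multiple (pull h \<rho>) (e3 l)"
        using pull_h_dvd[OF _ \<rho>(2) Dy] not_dvd_e' by (metis prime_elem_dvd_mult_iff)
      then consider "scalar_multiple (pull h \<rho>) (e1 l)" | "scalar_multiple (pull h \<rho>) e2"
        using contr[OF \<rho>(1,3)] by blast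
      hence "e2 \<in> R"
        by cases (use quot[OF \<rho>(2) _ Dy] e_nonzero[OF l] R_similar[OF _ R_pull] in blast)+
      thus ?thesis using e3R by blast
    qed
  qed
  then obtain r2 r3 where r: "e2 = pull h r2" "e3 l = pull h r3" unfolding R_def by blast
  have "xx = cst (- 1 / (l - 1)) * (e3 l + cst l * e2)"
    unfolding line_from_e[OF l] by (rule eval2_eqI) (use l in simp)
  hence "xx = pull h (cst (- 1 / (l - 1)) * (r3 + cst l * r2))" by (simp add: r)
  \<comment> \<open>As x comes from h, it is constant on every curve contracted by h. Such a curve
    is also contracted by the family member, on whose contracted curves x is not constant.\<close>
  hence xdvd: "t' dvd xx - cst (eval2 (cst (- 1 / (l - 1)) * (r3 + cst l * r2)) P')"
    using contracts_dvd[OF t'(2)] by metis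
  have "contracts (family l) t' (pmap g P')"
    unfolding contracts_def family_eq fst_conv snd_conv fst_pmap snd_pmap using contracts_dvd[OF t'(2)] by blast
  thus False using xx_not_const_mod_contracted[OF _ _ _] xdvd t'(1) by (simp add: prime_elem_def)
qed

end

section \<open>Birationality of the family\<close>

context
  fixes l :: "'a::alg_closed_field"
  assumes l: "l \<noteq> 0" "l \<noteq> 1"
begin

lemma family_birational_morphism: "birational_morphism (pmap (family l))"
proof -
  define a where "a = l - 1"
  have a: "a \<noteq> 0" using l by (simp add: a_def)
  define L where "L = xx + cst l * yy"
  define D where "D = parabola l"
  define U where "U = {P. eval2 (e1 l * e2 * e3 l * xx) P \<noteq> 0}"
  define V where "V = {Q. eval2 (xx * yy * D * L) Q \<noteq> 0}"
  \<comment> \<open>The inverse is found by solving for w and z. With (X, Y) = (E1 E3, E1 E2), the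
    pullbacks give D = -a E1 E2 E3 and L = -a E1 w, so E1 = -a X Y / D, E2 = -D / (a X) and w = L D
    / (a^2 X Y). Then z follows from E2 = -(1 + w + w^2 z).\<close>
  define p1 where "p1 = L * D"
  define q1 where "q1 = cst (a ^ 2) * xx * yy"
  define p2 where "p2 = (cst a * yy * D - cst (a ^ 2) * xx * yy - L * D) * (cst (a ^ 2) * xx * yy)"
  define q2 where "q2 = L ^ 2 * D ^ 2"
  define g where "g Q = (eval2 p1 Q / eval2 q1 Q, eval2 p2 Q / eval2 q2 Q)" for Q
  have open_UV: "zariski_open U" "zariski_open V" unfolding U_def V_def by (rule zariski_open_basic)+
  have "eval2 (xx * yy) (1, 1 :: 'a) \<noteq> 0" "eval2 D (l, 0) \<noteq> 0" "eval2 L (1, 0) \<noteq> 0" "eval2 xx (1, 0 :: 'a) \<noteq> 0"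
    using l by (simp_all add: D_def L_def parabola_def power2_eq_square)
  hence nz: "xx * yy \<noteq> (0 :: 'a poly poly)" "D \<noteq> 0" "L \<noteq> 0" "xx \<noteq> (0 :: 'a poly poly)" by (blast dest: eval2_nonzero_imp)+
  have ne: "U \<noteq> {}" "V \<noteq> {}" unfolding U_def V_def
    by (rule basic_open_nonempty; use nz e_nonzero[OF l] in simp)+
  have fU: "pmap (family l) P \<in> V \<and> g (pmap (family l) P) = P" if P: "P \<in> U" for P
  proof -
    define w z E1 E2 E3 where d: "w = fst P" "z = snd P" "E1 = eval2 (e1 l) P" "E2 = eval2 e2 P" "E3 = eval2 (e3 l) P"
    have E: "E1 \<noteq> 0" "E2 \<noteq> 0" "E3 \<noteq> 0" "w \<noteq> 0" using P by (auto simp: U_def d)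
    define x y where xy: "x = E1 * E3" "y = E1 * E2"
    have fP: "pmap (family l) P = (x, y)" by (simp add: xy d pmap_def family_def)
    have DL: "eval2 D (x, y) = - (a * E1 * E2 * E3)" "eval2 L (x, y) = - (a * E1 * w)"
    proof -
      show "eval2 D (x, y) = - (a * E1 * E2 * E3)"
        using arg_cong[OF pull_family_parabola[OF l], of "\<lambda>q. eval2 q P"] by (simp add: D_def fP a_def d)
      have "E3 + l * E2 = - (a * w)"
        using arg_cong[OF line_from_e[OF l], of "\<lambda>q. eval2 q P"] by (simp add: a_def d)
      hence "E1 * (E3 + l * E2) = E1 * - (a * w)" by simp
      thus "eval2 L (x, y) = - (a * E1 * w)" by (simp add: L_def xy algebra_simps)
    qed
    have V: "(x, y) \<in> V" using E a by (simp add: V_def DL) (simp add: xy)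
    have "eval2 p1 (x, y) / eval2 q1 (x, y) = w"
      using E a by (simp add: p1_def q1_def DL) (simp add: xy power2_eq_square field_simps)
    moreover have "eval2 p2 (x, y) / eval2 q2 (x, y) = z"
    proof -
      have E2: "E2 = - (1 + w + w ^ 2 * z)" by (simp add: d e2_def)
      have "a * y * eval2 D (x, y) - a ^ 2 * x * y - eval2 L (x, y) * eval2 D (x, y) = - (a ^ 2 * E1 ^ 2 * E2 * E3 * (E2 + 1 + w))"
        unfolding DL unfolding xy by (simp add: algebra_simps power2_eq_square)
      also have "E2 + 1 + w = - (w ^ 2 * z)" unfolding E2 by simp
      finally have num: "a * y * eval2 D (x, y) - a ^ 2 * x * y - eval2 L (x, y) * eval2 D (x, y) = a ^ 2 * E1 ^ 2 * E2 * E3 * (w ^ 2 * z)"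
        by simp
      have "eval2 p2 (x, y) = (a ^ 2 * E1 ^ 2 * E2 * E3 * (w ^ 2 * z)) * (a ^ 2 * x * y)"
        unfolding num[symmetric] by (simp add: p2_def)
      moreover have "eval2 q2 (x, y) = (a * E1 * w) ^ 2 * (a * E1 * E2 * E3) ^ 2" by (simp add: q2_def DL)
      ultimately show ?thesis using E a unfolding xy by (simp add: power2_eq_square field_simps)
    qed
    ultimately show ?thesis using V unfolding fP g_def by (simp add: d)
  qed
  have gV: "g Q \<in> U \<and> pmap (family l) (g Q) = Q" if Q: "Q \<in> V" for Q
  proof -
    obtain x y where xy: "Q = (x, y)" by fastforce
    define d m where dm: "d = eval2 D Q" "m = eval2 L Q"
    have nz: "x \<noteq> 0" "y \<noteq> 0" "d \<noteq> 0" "m \<noteq> 0" using Q by (auto simp: V_def dm xy)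
    have m: "m = x + l * y" and dd: "d + x + l ^ 2 * y = m ^ 2" by (simp_all add: dm L_def D_def parabola_def xy)
    define w z where w: "w = m * d / (a ^ 2 * x * y)" 
      and z: "z = (a * y * d - a ^ 2 * x * y - m * d) * (a ^ 2 * x * y) / (m ^ 2 * d ^ 2)"
    have gQ: "g Q = (w, z)" by (simp add: g_def w z p1_def p2_def q1_def q2_def xy flip: dm) (simp add: dm xy)
    define E1 E2 E3 where E: "E1 = eval2 (e1 l) (w, z)" "E2 = eval2 e2 (w, z)" "E3 = eval2 (e3 l) (w, z)"
    have w0: "w \<noteq> 0" using nz a by (simp add: w)
    have w2z: "w ^ 2 * z = (a * y * d - a ^ 2 * x * y - m * d) / (a ^ 2 * x * y)"
      using nz a unfolding w z by (simp add: power2_eq_square)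
    have E2: "E2 = - d / (a * x)"
    proof -
      have "E2 = - (1 + w + w ^ 2 * z)" by (simp add: E e2_def)
      also have "\<dots> = - d / (a * x)" unfolding w2z using nz a unfolding w by (simp add: field_simps power2_eq_square)
      finally show ?thesis .
    qed
    have E3: "E3 = - d / (a * y)"
    proof -
      have "E3 + l * E2 = - (a * w)"
        using arg_cong[OF line_from_e[OF l], of "\<lambda>q. eval2 q (w, z)"] by (simp add: a_def E)
      hence "E3 = - (a * w) - l * E2" by (simp add: algebra_simps)
      also have "\<dots> = - d / (a * y)" using nz a unfolding w E2 m by (simp add: field_simps power2_eq_square)
      finally show ?thesis .
    qed
    have E1: "E1 = - a * x * y / d"
    proof -
      have "a * E1 * w ^ 2 = - (E2 * E3) + 1 / a * (E3 + l ^ 2 * E2)"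
        using arg_cong[OF e1_line[OF l], of "\<lambda>q. eval2 q (w, z)"] by (simp add: a_def E)
      also have "\<dots> = - d * (d + x + l ^ 2 * y) / (a ^ 2 * x * y)"
        using nz a unfolding E2 E3 by (simp add: field_simps power2_eq_square)
      also have "\<dots> = a * (- a * x * y / d) * w ^ 2"
        unfolding dd using nz a unfolding w by (simp add: field_simps power2_eq_square)
      finally have "(a * w ^ 2) * E1 = (a * w ^ 2) * (- a * x * y / d)" by (simp only: mult_ac)
      moreover have "a * w ^ 2 \<noteq> 0" using w0 a by simp
      ultimately show ?thesis using mult_left_cancel by blast
    qed
    have "g Q \<in> U" unfolding U_def gQ using nz a w0 E1 E2 E3 by (simp flip: E)
    moreover have "pmap (family l) (g Q) = Q"
      unfolding gQ using nz a by (simp add: pmap_def family_def xy flip: E) (simp add: E1 E2 E3)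
    ultimately show ?thesis by blast
  qed
  have "regular_on V (fst \<circ> g)" "regular_on V (snd \<circ> g)"
    by (rule regular_on_fraction[OF open_UV(2), of q1 _ p1], use a in \<open>simp add: g_def V_def q1_def\<close>)
      (rule regular_on_fraction[OF open_UV(2), of q2 _ p2], simp add: g_def V_def q2_def)
  hence "morphism V U g" using gV unfolding morphism_def by blast
  moreover have "regular_on U (fst \<circ> pmap (family l))" "regular_on U (snd \<circ> pmap (family l))"
    by (rule regular_on_fraction[OF open_UV(1), of 1 _ "fst (family l)"], simp)
      (rule regular_on_fraction[OF open_UV(1), of 1 _ "snd (family l)"], simp)
  hence "morphism U V (pmap (family l))" using fU unfolding morphism_def by blast
  ultimately have "isomorphism U V (pmap (family l))"
    unfolding isomorphism_def using fU gV by blast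
  moreover have "morphism UNIV UNIV (pmap (family l))" using morphism_UNIV_iff by blast
  ultimately show ?thesis unfolding birational_morphism_def using open_UV ne by blast
qed

lemma family_birational: "birational (family l)"
  using birational_morphism_imp_birational[OF family_birational_morphism] pmap_inject by metis

text \<open>Comparison with the square of the pulled-back parabola would give (l - 1)^2 q x y = c
  D^2 with D the parabola, but D is nonzero at (l, 0). This will rule out equivalences that carry
  \<open>e1\<close> to \<open>e2\<close> or \<open>e3\<close>.\<close>

lemma e2_e3_not_in_range: "cst c * (e2 * e3 l) \<noteq> pull (family l) q" if "c \<noteq> 0"
proof
  assume q: "cst c * (e2 * e3 l) = pull (family l) q"
  have "pull (family l) (cst ((l - 1) ^ 2) * q * (xx * yy)) =
      cst ((l - 1) ^ 2) * (cst c * (e2 * e3 l)) * ((e1 l * e3 l) * (e1 l * e2))"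
    unfolding q by (simp add: family_def)
  also have "\<dots> = cst c * (- (cst (l - 1) * e1 l * e2 * e3 l)) ^ 2"
    by (rule eval2_eqI) (simp add: power2_eq_square)
  also have "\<dots> = pull (family l) (cst c * parabola l ^ 2)" by (simp add: pull_family_parabola[OF l])
  finally have "cst ((l - 1) ^ 2) * q * (xx * yy) = cst c * parabola l ^ 2"
    using birational_pull_eq_iff[OF family_birational] by blast
  hence "eval2 (cst ((l - 1) ^ 2) * q * (xx * yy)) (l, 0) = eval2 (cst c * parabola l ^ 2) (l, 0)" by simp
  thus False using l that by (simp add: parabola_def power2_eq_square)
qed

end

section \<open>Equivalence in the family\<close>

lemma scalar_multiple_trans: "scalar_multiple p q \<Longrightarrow> scalar_multiple q r \<Longrightarrow> scalar_multiple p r"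
  unfolding scalar_multiple_def
proof (elim exE conjE)
  fix c d assume "c \<noteq> 0" "p = cst c * q" "d \<noteq> 0" "q = cst d * r"
  moreover from this have "p = cst (c * d) * r" by (intro eval2_eqI) simp
  ultimately show "\<exists>c. c \<noteq> 0 \<and> p = cst c * r" by (metis mult_eq_0_iff)
qed

lemma scalar_multiple_mult:
  "scalar_multiple p q \<Longrightarrow> scalar_multiple p' q' \<Longrightarrow> scalar_multiple (p * p') (q * q')"
  unfolding scalar_multiple_def
proof (elim exE conjE)
  fix c d assume "c \<noteq> 0" "p = cst c * q" "d \<noteq> 0" "p' = cst d * q'"
  moreover from this have "p * p' = cst (c * d) * (q * q')" by (intro eval2_eqI) simp
  ultimately show "\<exists>c. c \<noteq> 0 \<and> p * p' = cst c * (q * q')" by (metis mult_eq_0_iff)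
qed

lemma scalar_multiple_pull_cancel:
  assumes "birational \<phi>" "scalar_multiple (pull \<phi> p) (pull \<phi> q)"
  shows "scalar_multiple p q"
proof -
  obtain c where c: "c \<noteq> 0" "pull \<phi> p = cst c * pull \<phi> q" using assms(2) unfolding scalar_multiple_def by blast
  hence "pull \<phi> p = pull \<phi> (cst c * q)" by simp
  hence "p = cst c * q" using birational_pull_eq_iff[OF assms(1)] by blast
  thus ?thesis using c(1) unfolding scalar_multiple_def by blast
qed

lemma AutE:
  assumes "u \<in> Aut"
  obtains \<phi> \<psi> where "u = pmap \<phi>" "\<And>q. pull \<psi> (pull \<phi> q) = q" "\<And>q. pull \<phi> (pull \<psi> q) = q"
    "pmap \<psi> \<circ> u = id" "u \<circ> pmap \<psi> = id"
proof -
  obtain \<phi> \<psi> where u: "u = pmap \<phi>" "pmap \<psi> \<circ> u = id" "u \<circ> pmap \<psi> = id" using assms unfolding Aut_iff by blast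
  have "pull \<psi> (pull \<phi> q) = q" "pull \<phi> (pull \<psi> q) = q" for q
    by (rule eval2_eqI; use u in \<open>simp add: fun_eq_iff del: split_paired_All\<close>)+
  thus ?thesis using that u by blast
qed

text \<open>The source automorphism permutes the contracted curves up to constants. It must match
  the two curves e1, because e1 divides both coordinates of the map. Hence the target automorphism
  is the identity or the swap of coordinates, and it carries one parabola to the other; a comparison
  of their values gives the relation between m and l.\<close>

lemma family_equivalent:
  fixes l m :: "'a::alg_closed_field"
  assumes l: "l \<noteq> 0" "l \<noteq> 1" and m: "m \<noteq> 0" "m \<noteq> 1"
    and u: "u \<in> Aut" and v: "v \<in> Aut" and eq: "pmap (family m) = u \<circ> pmap (family l) \<circ> v"
  shows "m = l \<or> m * l = 1"
proof -
  obtain \<phi> \<phi>' where \<phi>: "u = pmap \<phi>" "pmap \<phi>' \<circ> u = id" "u \<circ> pmap \<phi>' = id" using u by (rule AutE)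
  obtain \<psi> \<psi>' where \<psi>: "v = pmap \<psi>" "\<And>q. pull \<psi>' (pull \<psi> q) = q" "\<And>q. pull \<psi> (pull \<psi>' q) = q"
    "pmap \<psi>' \<circ> v = id" "v \<circ> pmap \<psi>' = id" using AutE[OF v] by blast
  define T where "T = pull \<psi>'"
  have comm: "T (pull (family m) q) = pull (family l) (pull \<phi> q)" for q
  proof (rule eval2_eqI)
    fix P
    have "pmap (family m) (pmap \<psi>' P) = u (pmap (family l) (v (pmap \<psi>' P)))" by (simp add: eq)
    also have "v (pmap \<psi>' P) = P" using \<psi>(5) by (metis comp_apply id_apply)
    finally show "eval2 (T (pull (family m) q)) P = eval2 (pull (family l) (pull \<phi> q)) P"
      by (simp add: T_def \<phi>(1))
  qed
  have T_mult: "T (p * q) = T p * T q" for p q by (simp add: T_def)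
  have T_contr: "\<exists>P. pmap \<phi> P = Q \<and> (P = (0, 0) \<and> scalar_multiple (T e) (e1 l) \<or>
      P = (1, 0) \<and> scalar_multiple (T e) e2 \<or> P = (0, 1) \<and> scalar_multiple (T e) (e3 l))"
    if e: "contracts (family m) e Q" "e \<noteq> 0" "\<not> is_unit e" for e Q
  proof (intro exI conjI contracted_by_family[OF l])
    show "pmap \<phi> (pmap \<phi>' Q) = Q" using \<phi> by (metis comp_apply id_apply)
    show "T e \<noteq> 0" using e(2) \<psi>(3)[of e] unfolding T_def by auto
    show "\<not> is_unit (T e)"
    proof
      assume "is_unit (T e)"
      then obtain c where "c \<noteq> 0" "T e = cst c" using is_unit_iff_cst by blast
      hence "c \<noteq> 0" "e = cst c" using \<psi>(3)[of e] unfolding T_def by auto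
      thus False using e(3) is_unit_iff_cst by blast
    qed
    have dvd: "T e dvd pull (family l) (pull \<phi> q) - cst (eval2 q Q)" for q
    proof -
      have "T e dvd T (pull (family m) q - cst (eval2 q Q))"
        unfolding T_def by (rule pull_dvd) (rule contracts_dvd[OF e(1)])
      also have "\<dots> = T (pull (family m) q) - cst (eval2 q Q)" by (simp add: T_def)
      finally show ?thesis by (simp only: comm)
    qed
    have "pull \<phi> (pull \<phi>' q) = q" for q
      by (rule eval2_eqI) (use \<phi> in \<open>simp add: fun_eq_iff del: split_paired_All\<close>)
    from dvd[of "fst \<phi>'"] dvd[of "snd \<phi>'"] this[of xx] this[of yy]
    show "contracts (family l) (T e) (pmap \<phi>' Q)" unfolding contracts_def by simp
  qed
  note c1 = T_contr[OF family_contracts(1)[OF m] e_nonzero(1)[OF m] not_unit_e(1)[OF m]]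
  note c2 = T_contr[OF family_contracts(2)[OF m] e_nonzero(2)[OF m] not_unit_e(2)[OF m]]
  note c3 = T_contr[OF family_contracts(3)[OF m] e_nonzero(3)[OF m] not_unit_e(3)[OF m]]
  have cx: "T (e1 m) * T (e3 m) = pull (family l) (fst \<phi>)" using comm[of xx] by (simp add: T_mult family_def)
  have cy: "T (e1 m) * T e2 = pull (family l) (snd \<phi>)" using comm[of yy] by (simp add: T_mult family_def)
  have no23: "\<not> scalar_multiple (pull (family l) q) (e2 * e3 l)" "\<not> scalar_multiple (pull (family l) q) (e3 l * e2)" for q
    using e2_e3_not_in_range[OF l] unfolding scalar_multiple_def by (metis mult.commute)+
  \<comment> \<open>The pullback of a parabola is e1 e2 e3 up to a constant for either parameter, so
    matching these products matches the parabolas.\<close>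
  have D: "scalar_multiple (pull \<phi> (parabola m)) (parabola l)"
    if "scalar_multiple (T (e1 m)) (e1 l)" "scalar_multiple (T e2 * T (e3 m)) (e2 * e3 l)"
  proof -
    have "scalar_multiple (cst (- (k - 1)) * p) p" if "k \<noteq> 1" for k and p :: "'a poly poly"
      using that unfolding scalar_multiple_def by (intro exI[of _ "- (k - 1)"]) simp
    note sc = this
    have par: "pull (family k) (parabola k) = cst (- (k - 1)) * (e1 k * (e2 * e3 k))" if "k \<noteq> 0" "k \<noteq> 1" for k :: 'a
      unfolding pull_family_parabola[OF that] by (rule eval2_eqI) (simp add: algebra_simps)
    have "pull (family l) (pull \<phi> (parabola m)) = cst (- (m - 1)) * (T (e1 m) * (T e2 * T (e3 m)))"
      unfolding comm[symmetric] par[OF m] by (simp add: T_def)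
    moreover have "scalar_multiple (T (e1 m) * (T e2 * T (e3 m))) (e1 l * (e2 * e3 l))"
      using that scalar_multiple_mult by blast
    ultimately have "scalar_multiple (pull (family l) (pull \<phi> (parabola m))) (pull (family l) (parabola l))"
      unfolding par[OF l] using sc[OF m(2)] sc[OF l(2)] scalar_multiple_trans scalar_multiple_sym by metis
    thus ?thesis using scalar_multiple_pull_cancel[OF family_birational[OF l]] by blast
  qed
  have par_eq: "eval2 (parabola k) (x, y) = (x + k * y) ^ 2 - (x + k ^ 2 * y)" for k x y :: 'a
    by (simp add: parabola_def)
  have coords: "q = p" if "scalar_multiple (pull (family l) q) (pull (family l) p)" "eval2 p P = 1" "eval2 q P = 1" for p q P
  proof -
    from scalar_multiple_pull_cancel[OF family_birational[OF l] that(1)] obtain c where c: "q = cst c * p"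
      unfolding scalar_multiple_def by blast
    have "c = 1" using that(2,3) unfolding c by simp
    thus ?thesis unfolding c by (intro eval2_eqI) simp
  qed
  have cases: "scalar_multiple (T (e1 m)) (e1 l) \<and>
    (pmap \<phi> (1, 0) = (1, 0) \<and> scalar_multiple (T e2) e2 \<and> pmap \<phi> (0, 1) = (0, 1) \<and> scalar_multiple (T (e3 m)) (e3 l) \<or>
     pmap \<phi> (0, 1) = (1, 0) \<and> scalar_multiple (T e2) (e3 l) \<and> pmap \<phi> (1, 0) = (0, 1) \<and> scalar_multiple (T (e3 m)) e2)"
  proof -
    \<comment> \<open>If T sent e1 to \<open>e2\<close> or \<open>e3 l\<close>, and another curve to
      the other of these two, a coordinate of \<open>\<phi>\<close> would pull back to a constant
      multiple of \<open>e2 * e3 l\<close>.\<close>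
    have bad: False if "scalar_multiple (T (e1 m)) p" "scalar_multiple (T (e3 m)) q"
        "scalar_multiple (T e2) r" "{p, q} = {e2, e3 l} \<or> {p, r} = {e2, e3 l}" for p q r
    proof -
      have "scalar_multiple (pull (family l) (fst \<phi>)) (p * q)" "scalar_multiple (pull (family l) (snd \<phi>)) (p * r)"
        unfolding cx[symmetric] cy[symmetric] using that scalar_multiple_mult by blast+
      thus False using that(4) no23 by (auto simp: doubleton_eq_iff)
    qed
    obtain P1 P2 P3 where P: "pmap \<phi> P1 = (0, 0)" "pmap \<phi> P2 = (1, 0)" "pmap \<phi> P3 = (0, 1)"
      and d1: "P1 = (0, 0) \<and> scalar_multiple (T (e1 m)) (e1 l) \<or>
        P1 = (1, 0) \<and> scalar_multiple (T (e1 m)) e2 \<or> P1 = (0, 1) \<and> scalar_multiple (T (e1 m)) (e3 l)"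
      and d2: "P2 = (0, 0) \<and> scalar_multiple (T e2) (e1 l) \<or>
        P2 = (1, 0) \<and> scalar_multiple (T e2) e2 \<or> P2 = (0, 1) \<and> scalar_multiple (T e2) (e3 l)"
      and d3: "P3 = (0, 0) \<and> scalar_multiple (T (e3 m)) (e1 l) \<or>
        P3 = (1, 0) \<and> scalar_multiple (T (e3 m)) e2 \<or> P3 = (0, 1) \<and> scalar_multiple (T (e3 m)) (e3 l)"
      using c1 c2 c3 by blast
    have dist: "P1 \<noteq> P2" "P1 \<noteq> P3" "P2 \<noteq> P3" using P by auto
    from d1 d2 d3 show ?thesis
      by (elim disjE conjE) (use dist P in \<open>simp_all, (blast dest: bad)+\<close>)
  qed
  hence e1: "scalar_multiple (T (e1 m)) (e1 l)" by blast
  note pl = pull_family[OF l]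
  from cases consider
      "pmap \<phi> (1, 0) = (1, 0)" "pmap \<phi> (0, 1) = (0, 1)" "scalar_multiple (T e2) e2" "scalar_multiple (T (e3 m)) (e3 l)"
    | "pmap \<phi> (0, 1) = (1, 0)" "pmap \<phi> (1, 0) = (0, 1)" "scalar_multiple (T e2) (e3 l)" "scalar_multiple (T (e3 m)) e2"
    by blast
  thus ?thesis
  proof cases
    case 1
    have "scalar_multiple (pull (family l) (fst \<phi>)) (pull (family l) xx)" "scalar_multiple (pull (family l) (snd \<phi>)) (pull (family l) yy)"
      unfolding pl cx[symmetric] cy[symmetric] using scalar_multiple_mult e1 1 by blast+
    \<comment> \<open>The coordinates are known up to constants, and the images of (1,0) and (0,1)
      fix these constants.\<close>
    hence f: "fst \<phi> = xx" "snd \<phi> = yy"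
      using coords[of "fst \<phi>" xx "(1, 0)"] coords[of "snd \<phi>" yy "(0, 1)"] 1(1,2) by (simp_all add: pmap_def)
    obtain c where c: "pull \<phi> (parabola m) = cst c * parabola l"
      using D[OF e1 scalar_multiple_mult[OF 1(3,4)]] unfolding scalar_multiple_def by blast
    have ev: "(x + m * y) ^ 2 - (x + m ^ 2 * y) = c * ((x + l * y) ^ 2 - (x + l ^ 2 * y))" for x y
      using arg_cong[OF c, of "\<lambda>q. eval2 q (x, y)"] by (simp add: par_eq pmap_def f)
    \<comment> \<open>The test points (l,0) and (0,l) are used because l * (l - 1) \<noteq>
      0.\<close>
    have "l * (l - 1) = c * (l * (l - 1))" using ev[of l 0] by (simp add: power2_eq_square algebra_simps)
    hence c1: "c = 1" using l by simp
    have "m ^ 2 * (l * (l - 1)) = l ^ 2 * (l * (l - 1))" using ev[of 0 l] by (simp add: power2_eq_square algebra_simps c1)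
    hence sq: "m ^ 2 = l ^ 2" using l by simp
    have "2 * m = 2 * l" using ev[of 1 1] by (simp add: power2_eq_square algebra_simps c1)
    \<comment> \<open>In characteristic 2 the equation 2 m = 2 l is void; together with m^2 = l^2 it
      still gives (m - l)^2 = 0, uniformly in all characteristics.\<close>
    hence "(m - l) ^ 2 = m ^ 2 + l ^ 2 - 2 * l * l" by (auto simp: power2_eq_square algebra_simps)
    also have "\<dots> = 0" unfolding sq by (simp add: power2_eq_square)
    finally show ?thesis by simp
  next
    case 2
    have "scalar_multiple (pull (family l) (fst \<phi>)) (pull (family l) yy)" "scalar_multiple (pull (family l) (snd \<phi>)) (pull (family l) xx)"
      unfolding pl cx[symmetric] cy[symmetric] using scalar_multiple_mult e1 2 by blast+
    hence f: "fst \<phi> = yy" "snd \<phi> = xx"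
      using coords[of "fst \<phi>" yy "(0, 1)"] coords[of "snd \<phi>" xx "(1, 0)"] 2(1,2) by (simp_all add: pmap_def)
    have "scalar_multiple (T e2 * T (e3 m)) (e2 * e3 l)" using scalar_multiple_mult[OF 2(3,4)] by (simp add: mult.commute)
    then obtain c where c: "pull \<phi> (parabola m) = cst c * parabola l"
      using D[OF e1] unfolding scalar_multiple_def by blast
    have ev: "(y + m * x) ^ 2 - (y + m ^ 2 * x) = c * ((x + l * y) ^ 2 - (x + l ^ 2 * y))" for x y
      using arg_cong[OF c, of "\<lambda>q. eval2 q (x, y)"] by (simp add: par_eq pmap_def f)
    have "m ^ 2 * (l * (l - 1)) = c * (l * (l - 1))" using ev[where x = l and y = 0] by (simp add: power2_eq_square algebra_simps)
    hence c1: "c = m ^ 2" using l by simp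
    have "l * (l - 1) = m ^ 2 * l ^ 2 * (l * (l - 1))" using ev[where x = 0 and y = l] by (simp add: power2_eq_square algebra_simps c1)
    hence sq: "m ^ 2 * l ^ 2 = 1" using l by simp
    have "2 * m = 2 * m ^ 2 * l" using ev[of 1 1] by (simp add: power2_eq_square algebra_simps c1)
    hence "m * 2 = m * (2 * (m * l))" by (simp add: power2_eq_square mult_ac)
    hence two: "2 = 2 * (m * l)" using mult_left_cancel[OF m(1)] by blast
    have "(m * l - 1) ^ 2 = m ^ 2 * l ^ 2 + 1 - 2 * (m * l)" by (simp add: power2_eq_square algebra_simps)
    also have "\<dots> = 0" unfolding sq two[symmetric] by simp
    finally show ?thesis by simp
  qed
qed

section \<open>Cardinality\<close>

lemma lepoll_iff_card_of: "A \<lesssim> B \<longleftrightarrow> (card_of A, card_of B) \<in> ordLeq"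
  unfolding lepoll_def by (rule card_of_ordLeq)

lemma infinite_times_self_lepoll:
  assumes "infinite A" shows "A \<times> A \<lesssim> A"
  unfolding lepoll_iff_card_of using card_of_Times_same_infinite[OF assms] by (rule ordIso_imp_ordLeq)

text \<open>Polynomials with at most n coefficients embed by induction, since an infinite set
  absorbs its square; then a countable union is taken.\<close>

lemma poly_lepoll:
  assumes inf: "infinite (UNIV :: 'b::zero set)"
  shows "(UNIV :: 'b poly set) \<lesssim> (UNIV :: 'b set)"
proof -
  define A where "A n = {p :: 'b poly. \<forall>i\<ge>n. coeff p i = 0}" for n
  have "A n \<lesssim> (UNIV :: 'b set)" for n
  proof (induction n)
    case 0
    have "A 0 = {0}" by (auto simp: A_def poly_eq_iff)
    thus ?case by (simp only:) (rule finite_lepoll_infinite[OF inf], simp)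
  next
    case (Suc n)
    have "A (Suc n) \<subseteq> (\<lambda>(c, p). pCons c p) ` (UNIV \<times> A n)"
    proof
      fix p assume p: "p \<in> A (Suc n)"
      obtain c q where cq: "p = pCons c q" by (cases p)
      hence "q \<in> A n" using p by (auto simp: A_def dest: spec[of _ "Suc _"])
      thus "p \<in> (\<lambda>(c, p). pCons c p) ` (UNIV \<times> A n)" using cq by force
    qed
    hence "A (Suc n) \<lesssim> (UNIV :: 'b set) \<times> A n" by (rule lepoll_trans[OF subset_imp_lepoll image_lepoll])
    also have "\<dots> \<lesssim> (UNIV :: 'b set) \<times> (UNIV :: 'b set)" by (rule times_lepoll_mono[OF lepoll_refl Suc])
    also have "\<dots> \<lesssim> (UNIV :: 'b set)" by (rule infinite_times_self_lepoll[OF inf])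
    finally show ?case .
  qed
  moreover have "(card_of (UNIV :: nat set), card_of (UNIV :: 'b set)) \<in> ordLeq"
    using inf unfolding infinite_le_lepoll lepoll_iff_card_of .
  ultimately have "(\<Union>n. A n) \<lesssim> (UNIV :: 'b set)"
    unfolding lepoll_iff_card_of by (intro card_of_UNION_ordLeq_infinite[OF inf]) auto
  moreover have "(\<Union>n. A n) = UNIV"
  proof -
    have "p \<in> A (Suc (degree p))" for p by (auto simp: A_def coeff_eq_0)
    thus ?thesis by blast
  qed
  ultimately show ?thesis by simp
qed

lemma birational_morphisms_lepoll:
  "{f :: 'a::alg_closed_field plane \<Rightarrow> 'a plane. birational_morphism f} \<lesssim> (UNIV :: 'a set)"
proof -
  have inf2: "infinite (UNIV :: 'a set)" by (rule infinite_alg_closed_field)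
  have "inj (\<lambda>a :: 'a. [:a:])" by (rule injI) simp
  hence inf1: "infinite (UNIV :: 'a poly set)" using inf2 finite_imageD finite_subset[OF subset_UNIV] by blast
  note inf = inf1 inf2
  have poly: "(UNIV :: 'a poly poly set) \<lesssim> (UNIV :: 'a set)"
    using poly_lepoll[OF inf(1)] poly_lepoll[OF inf(2)] by (rule lepoll_trans)
  have "{f :: 'a plane \<Rightarrow> 'a plane. birational_morphism f} \<subseteq> range pmap"
  proof
    fix f :: "'a plane \<Rightarrow> 'a plane" assume "f \<in> {f. birational_morphism f}"
    hence "birational_morphism f" by simp
    then obtain \<phi> where "f = pmap \<phi>" by (rule birational_morphism_imp_birational)
    thus "f \<in> range pmap" by simp
  qed
  hence "{f :: 'a plane \<Rightarrow> 'a plane. birational_morphism f} \<lesssim> (UNIV :: ('a poly poly \<times> 'a poly poly) set)"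
    by (rule lepoll_trans[OF subset_imp_lepoll image_lepoll])
  also have "\<dots> \<lesssim> (UNIV :: 'a set) \<times> (UNIV :: 'a set)"
    unfolding UNIV_Times_UNIV[symmetric] by (rule times_lepoll_mono[OF poly poly])
  also have "\<dots> \<lesssim> (UNIV :: 'a set)" by (rule infinite_times_self_lepoll[OF inf(2)])
  finally show ?thesis .
qed

text \<open>Let C be the class of f under composition with automorphisms on both sides.
  Irreducibility carries over to C, so if a product lies in C, one factor is an automorphism and the
  other lies in C. The complement of C is thus a submonoid containing \<open>Aut\<close>; were S
  disjoint from C, it would contain all generators but not f.\<close>

lemma irreducible_in_generating_set:
  fixes f :: "'a::alg_closed_field plane \<Rightarrow> 'a plane"
  assumes gen: "generates_monoid Bir (Aut \<union> S)"
    and f: "birational_morphism f" "f \<notin> Aut"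
    and irr: "\<And>g h. birational_morphism g \<Longrightarrow> birational_morphism h \<Longrightarrow> f = g \<circ> h \<Longrightarrow> g \<in> Aut \<or> h \<in> Aut"
  obtains s u v where "s \<in> S" "u \<in> Aut" "v \<in> Aut" "s = u \<circ> f \<circ> v"
proof -
  define C where "C = {u \<circ> f \<circ> v | u v. u \<in> Aut \<and> v \<in> Aut}"
  have C_left: "u \<circ> x \<in> C" if "x \<in> C" "u \<in> Aut" for x u
  proof -
    from that(1) obtain u' v' where "x = u' \<circ> f \<circ> v'" "u' \<in> Aut" "v' \<in> Aut" unfolding C_def by blast
    moreover have "u \<circ> (u' \<circ> f \<circ> v') = (u \<circ> u') \<circ> f \<circ> v'" by (simp add: comp_assoc)
    ultimately show ?thesis unfolding C_def using Aut_comp[OF that(2)] by blast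
  qed
  have C_right: "x \<circ> u \<in> C" if "x \<in> C" "u \<in> Aut" for x u
  proof -
    from that(1) obtain u' v' where "x = u' \<circ> f \<circ> v'" "u' \<in> Aut" "v' \<in> Aut" unfolding C_def by blast
    moreover have "(u' \<circ> f \<circ> v') \<circ> u = u' \<circ> f \<circ> (v' \<circ> u)" by (simp add: comp_assoc)
    ultimately show ?thesis unfolding C_def using Aut_comp[OF _ that(2)] by blast
  qed
  have C_Aut: "x \<notin> Aut" if "x \<in> C" for x
  proof
    assume x: "x \<in> Aut"
    from that obtain u v where uv: "x = u \<circ> f \<circ> v" "u \<in> Aut" "v \<in> Aut" unfolding C_def by blast
    obtain u' v' where u': "u' \<in> Aut" "u' \<circ> u = id" and v': "v' \<in> Aut" "v \<circ> v' = id"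
      using Aut_inverse uv(2,3) by metis
    have "u' \<circ> x \<circ> v' = (u' \<circ> u) \<circ> f \<circ> (v \<circ> v')" by (simp add: uv(1) comp_assoc)
    hence "f = u' \<circ> x \<circ> v'" by (simp add: u' v')
    thus False using f(2) u'(1) v'(1) x Aut_comp by metis
  qed
  have C_split: "g \<in> C \<or> h \<in> C" if gh: "birational_morphism g" "birational_morphism h" "g \<circ> h \<in> C" for g h
  proof -
    from gh(3) obtain u v where uv: "g \<circ> h = u \<circ> f \<circ> v" "u \<in> Aut" "v \<in> Aut" unfolding C_def by blast
    obtain u' v' where u': "u' \<in> Aut" "u' \<circ> u = id" "u \<circ> u' = id" and v': "v' \<in> Aut" "v \<circ> v' = id" "v' \<circ> v = id"
      using Aut_inverse uv(2,3) by metis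
    have "(u' \<circ> g) \<circ> (h \<circ> v') = u' \<circ> (g \<circ> h) \<circ> v'" by (simp add: comp_assoc)
    also have "\<dots> = (u' \<circ> u) \<circ> f \<circ> (v \<circ> v')" unfolding uv(1) by (simp add: comp_assoc)
    finally have "f = (u' \<circ> g) \<circ> (h \<circ> v')" by (simp add: u' v')
    moreover have "birational_morphism (u' \<circ> g)" "birational_morphism (h \<circ> v')"
      using birational_morphism_comp gh(1,2) u'(1) v'(1) Aut_imp_birational_morphism by blast+
    ultimately have "u' \<circ> g \<in> Aut \<or> h \<circ> v' \<in> Aut" using irr by blast
    moreover have "u \<circ> (u' \<circ> g) = g" "(h \<circ> v') \<circ> v = h"
      using u'(3) v'(3) by (metis comp_assoc id_comp comp_id)+
    ultimately have "g \<in> Aut \<or> h \<in> Aut" using Aut_comp uv(2,3) by metis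
    thus ?thesis
    proof
      assume "g \<in> Aut"
      then obtain g' where g': "g' \<in> Aut" "g' \<circ> g = id" using Aut_inverse by blast
      have "g' \<circ> (g \<circ> h) \<in> C" by (rule C_left[OF gh(3) g'(1)])
      also have "g' \<circ> (g \<circ> h) = h" using g'(2) by (metis comp_assoc id_comp)
      finally show ?thesis by simp
    next
      assume "h \<in> Aut"
      then obtain h' where h': "h' \<in> Aut" "h \<circ> h' = id" using Aut_inverse by blast
      have "(g \<circ> h) \<circ> h' \<in> C" by (rule C_right[OF gh(3) h'(1)])
      also have "(g \<circ> h) \<circ> h' = g" using h'(2) by (metis comp_assoc comp_id)
      finally show ?thesis by simp
    qed
  qed
  define H where "H = {g. birational_morphism g} - C"
  have "S \<inter> C \<noteq> {}"
  proof
    assume disj: "S \<inter> C = {}"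
    have bir: "x \<in> H \<Longrightarrow> birational_morphism x" for x by (simp add: H_def)
    have "submonoid H Bir"
    proof
      show "H \<subseteq> carrier Bir" by (auto simp: H_def Bir_def)
      show "x \<otimes>\<^bsub>Bir\<^esub> y \<in> H" if "x \<in> H" "y \<in> H" for x y
        using that C_split birational_morphism_comp by (auto simp: H_def Bir_def)
      show "\<one>\<^bsub>Bir\<^esub> \<in> H"
        using id_in_Aut C_Aut Aut_imp_birational_morphism by (auto simp: H_def Bir_def)
    qed
    moreover have "Aut \<union> S \<subseteq> H"
      using gen disj C_Aut unfolding generates_monoid_def H_def by (auto simp: Bir_def)
    ultimately have "H = carrier Bir" using gen unfolding generates_monoid_def by blast
    moreover have "f \<in> C" unfolding C_def using id_in_Aut by (intro CollectI exI[of _ id]) simp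
    ultimately show False using f(1) by (auto simp: H_def Bir_def)
  qed
  then obtain s where "s \<in> S" "s \<in> C" by blast
  thus ?thesis using that unfolding C_def by blast
qed

theorem corollary4p3:
  fixes S :: "('a::alg_closed_field plane \<Rightarrow> 'a plane) set"
  assumes "S \<subseteq> carrier Bir"
    and "generates_monoid Bir (Aut \<union> S)"
  shows "S \<approx> (UNIV :: 'a set)"
proof (rule lepoll_antisym)
  have "S \<subseteq> {f. birational_morphism f}" using assms(1) by (simp add: Bir_def)
  thus "S \<lesssim> (UNIV :: 'a set)" using birational_morphisms_lepoll lepoll_trans subset_imp_lepoll by blast
  \<comment> \<open>Here l is a root of X^2 - c X + 1, which is nonzero; l = 1 would force c =
    2.\<close>
  have root: "\<exists>l. l \<noteq> 0 \<and> l \<noteq> 1 \<and> l + 1 / l = c" if "c \<noteq> 2" for c :: 'a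
  proof -
    have "degree [:1, - c, 1:] > 0" by simp
    then obtain l where l: "poly [:1, - c, 1:] l = 0" using alg_closed_imp_poly_has_root by blast
    hence "l \<noteq> 0" by auto
    moreover from l this have "l + 1 / l = c" by (simp add: field_simps)
    moreover from this that have "l \<noteq> 1" by auto
    ultimately show ?thesis by blast
  qed
  then obtain r :: "'a \<Rightarrow> 'a" where r: "\<And>c. c \<noteq> 2 \<Longrightarrow> r c \<noteq> 0 \<and> r c \<noteq> 1 \<and> r c + 1 / r c = c" by metis
  have "\<exists>s u v. s \<in> S \<and> u \<in> Aut \<and> v \<in> Aut \<and> s = u \<circ> pmap (family (r c)) \<circ> v" if "c \<noteq> 2" for c
  proof -
    have rc: "r c \<noteq> 0" "r c \<noteq> 1" using r[OF that] by auto
    show ?thesis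
    proof (rule irreducible_in_generating_set[OF assms(2) family_birational_morphism[OF rc] family_not_Aut[OF rc]])
      fix g h assume "birational_morphism g" "birational_morphism h" and gh: "pmap (family (r c)) = g \<circ> h"
      then obtain \<phi> \<psi> where "g = pmap \<phi>" "birational \<phi>" "h = pmap \<psi>" "birational \<psi>"
        by (metis birational_morphism_imp_birational)
      thus "g \<in> Aut \<or> h \<in> Aut" using family_irreducible[OF rc] gh by blast
    qed blast
  qed
  then obtain s u v where s: "\<And>c. c \<noteq> 2 \<Longrightarrow> s c \<in> S \<and> u c \<in> Aut \<and> v c \<in> Aut \<and> s c = u c \<circ> pmap (family (r c)) \<circ> v c"
    by metis
  \<comment> \<open>If one member of S is equivalent to the maps chosen for c and for d, their
    parameters are equal or mutually inverse, so the invariants l + 1 / l agree.\<close>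
  have "inj_on s (UNIV - {2})"
  proof (rule inj_onI)
    fix c d assume "c \<in> UNIV - {2}" "d \<in> UNIV - {2}" and eq: "s c = s d"
    hence cd: "c \<noteq> 2" "d \<noteq> 2" by auto
    obtain u' v' where uv': "u' \<in> Aut" "u' \<circ> u c = id" "v' \<in> Aut" "v c \<circ> v' = id"
      using Aut_inverse s[OF cd(1)] by metis
    have "u' \<circ> s c \<circ> v' = (u' \<circ> u c) \<circ> pmap (family (r c)) \<circ> (v c \<circ> v')"
      using s[OF cd(1)] by (simp add: comp_assoc)
    hence "pmap (family (r c)) = u' \<circ> s d \<circ> v'" by (simp add: uv' eq)
    also have "\<dots> = (u' \<circ> u d) \<circ> pmap (family (r d)) \<circ> (v d \<circ> v')"
      using s[OF cd(2)] by (simp add: comp_assoc)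
    finally have "r c = r d \<or> r c * r d = 1"
      using family_equivalent[of "r d" "r c" "u' \<circ> u d" "v d \<circ> v'"] r[OF cd(1)] r[OF cd(2)]
        Aut_comp uv' s[OF cd(2)] by blast
    hence "r c + 1 / r c = r d + 1 / r d"
    proof
      assume *: "r c * r d = 1"
      hence "1 / r c = r d" "1 / r d = r c" using r[OF cd(1)] r[OF cd(2)] by (auto simp: field_simps)
      thus ?thesis by simp
    qed simp
    thus "c = d" using r[OF cd(1)] r[OF cd(2)] by simp
  qed
  moreover have "s ` (UNIV - {2}) \<subseteq> S" using s by (intro image_subsetI) blast
  ultimately have "UNIV - {2 :: 'a} \<lesssim> S" unfolding lepoll_def by (intro exI[of _ s] conjI)
  moreover have "(UNIV :: 'a set) \<lesssim> UNIV - {2 :: 'a}"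
  proof -
    have inf: "infinite (UNIV - {2 :: 'a})" by (rule infinite_remove) (rule infinite_alg_closed_field)
    have ins: "insert 2 (UNIV - {2}) = (UNIV :: 'a set)" by (simp add: insert_Diff_if)
    show ?thesis using infinite_insert_lepoll[OF inf, of 2] unfolding ins .
  qed
  ultimately show "(UNIV :: 'a set) \<lesssim> S" by (rule lepoll_trans[rotated])
qed

end
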